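(* Suppose the losses $\ell_t$ satisfy Assumptions B1–B2 and let $\gamma:=2GB\sqrt{\alpha d/2}+1/\sqrt{2\alpha}$. Let $x_t$ be the predictions of FLH-ONS. Then $$R_n(C_n)\le\sup_{\substack{w_1,\dots,w_n\in\mathcal D\\ \sum_{t=2}^n\|w_t-w_{t-1}\|_1\le C_n}}\sum_{t=1}^nf_t(x_t)-f_t(w_t)$$ and this is $$\tilde O\Big(140\,d^2\big(8G^2B^2\alpha d+G^2B^2+1/\alpha\big)\big(n^{1/3}C_n^{2/3}\vee1\big)\Big)\mathbb I\{C_n>1/n\}+\tilde O\Big(d\big(8G^2B^2\alpha d+1/\alpha\big)\Big)\mathbb I\{C_n\le1/n\},$$ where $\tilde O$ hides polynomial factors of $\log n$, and $\mathbb I\{\cdot\}$ is the $\{0,1\}$-valued indicator.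
   Context: $\mathcal D=\{x\in\mathbb R^d:\|x\|_\infty\le B\}$. At each $t\in[n]$ the learner predicts $x_t\in\mathcal D$ and then the adversary reveals a differentiable convex loss $\ell_t$. Assumption B1: for all $x,y\in\mathcal D$, $\ell_t(y)\ge\ell_t(x)+\nabla\ell_t(x)^T(y-x)+\frac\alpha2(\nabla\ell_t(x)^T(y-x))^2$, with $\alpha>0$. Assumption B2: $\|\nabla\ell_t(x)\|_2\le G$ and $\|\nabla\ell_t(x)\|_\infty\le G_\infty$ for all $x\in\mathcal D$, and $\min\{G,G_\infty,B\}\ge1$. Surrogate losses: $f_t(x)=\big(\sqrt{\alpha/2}\,\nabla\ell_t(x_t)^T(x-x_t)+1/\sqrt{2\alpha}\big)^2$. $R_n(C_n)=\sup\{\sum_{t=1}^n\ell_t(x_t)-\ell_t(w_t): w_t\in\mathcal D,\ \sum_{t=2}^n\|w_t-w_{t-1}\|_1\le C_n\}$. ONS with parameter $\beta$ on losses $h_1,h_2,\dots$ over $\mathcal D$: let $D_0=2B\sqrt d$, $\epsilon=1/(\beta^2D_0^2)$, $A_0=\epsilon I$, $z_1\in\mathcal D$ fixed; for $\tau\ge1$, $A_\tau=A_{\tau-1}+\nabla h_\tau(z_\tau)\nabla h_\tau(z_\tau)^T$, $w=z_\tau-\beta^{-1}A_\tau^{-1}\nabla h_\tau(z_\tau)$, $z_{\tau+1}=\arg\min_{z\in\mathcal D}(w-z)^TA_\tau(w-z)$. FLH-ONS: for each $j\in[n]$ a base learner $E^j$ started at time $j$ runs ONS with parameter $\zeta=\min\{\frac1{16GB\sqrt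 d},\frac1{4\gamma^2}\}$ on the losses $f_t$, $t\ge j$, producing $x^{(j)}_t$; the FLH meta-algorithm with learning rate $\eta=1/(2\gamma^2)$ keeps $v_t=(v^{(1)}_t,\dots,v^{(t)}_t)$, $v_1=(1)$, predicts $x_t=\sum_{j\le t}v^{(j)}_tx^{(j)}_t$, and after $f_t$ is formed sets $\hat v^{(i)}_{t+1}=v^{(i)}_te^{-\eta f_t(x^{(i)}_t)}/\sum_{j\le t}v^{(j)}_te^{-\eta f_t(x^{(j)}_t)}$ for $i\le t$, $v^{(t+1)}_{t+1}=1/(t+1)$, $v^{(i)}_{t+1}=(1-\frac1{t+1})\hat v^{(i)}_{t+1}$. $a\vee b=\max\{a,b\}$. *)

theory Defs
  imports Complex_Main
begin

text \<open>Vectors of R^d are represented as functions nat => real that vanish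
  outside {0..<d}; d x d matrices as functions nat => nat => real (only the
  entries with indices < d are used).  This keeps the dimension d a value,
  so that the constants hidden in the O-tilde bound can be required to be
  independent of d.\<close>

type_synonym rvec = "nat \<Rightarrow> real"
type_synonym rmat = "nat \<Rightarrow> nat \<Rightarrow> real"

definition vsupp :: "nat \<Rightarrow> rvec \<Rightarrow> bool" where
  "vsupp d x \<longleftrightarrow> (\<forall>i\<ge>d. x i = 0)"

definition dotp :: "nat \<Rightarrow> rvec \<Rightarrow> rvec \<Rightarrow> real" where
  "dotp d x y = (\<Sum>i<d. x i * y i)"

definition norm2 :: "nat \<Rightarrow> rvec \<Rightarrow> real" where
  "norm2 d x = sqrt (dotp d x x)"

definition norm1 :: "nat \<Rightarrow> rvec \<Rightarrow> real" where
  "norm1 d x = (\<Sum>i<d. \<bar>x i\<bar>)"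

definition norminf :: "nat \<Rightarrow> rvec \<Rightarrow> real" where
  "norminf d x = Max (insert 0 ((\<lambda>i. \<bar>x i\<bar>) ` {..<d}))"

definition domD :: "nat \<Rightarrow> real \<Rightarrow> rvec set" where
  "domD d B = {x. vsupp d x \<and> (\<forall>i<d. \<bar>x i\<bar> \<le> B)}"

definition has_grad :: "nat \<Rightarrow> (rvec \<Rightarrow> real) \<Rightarrow> rvec \<Rightarrow> rvec \<Rightarrow> bool" where
  "has_grad d f x g \<longleftrightarrow> vsupp d g \<and>
     (\<forall>e>0. \<exists>\<delta>>0. \<forall>h. vsupp d h \<and> norm2 d h < \<delta> \<longrightarrow>
        \<bar>f (\<lambda>i. x i + h i) - f x - dotp d g h\<bar> \<le> e * norm2 d h)"

definition convex_Rd :: "nat \<Rightarrow> (rvec \<Rightarrow> real) \<Rightarrow> bool" where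
  "convex_Rd d f \<longleftrightarrow> (\<forall>x y u. vsupp d x \<and> vsupp d y \<and> 0 \<le> u \<and> u \<le> 1 \<longrightarrow>
     f (\<lambda>i. u * x i + (1 - u) * y i) \<le> u * f x + (1 - u) * f y)"

definition mat_vec :: "nat \<Rightarrow> rmat \<Rightarrow> rvec \<Rightarrow> rvec" where
  "mat_vec d A y = (\<lambda>i. if i < d then (\<Sum>j<d. A i j * y j) else 0)"

definition minv_apply :: "nat \<Rightarrow> rmat \<Rightarrow> rvec \<Rightarrow> rvec" where
  "minv_apply d A g = (SOME y. vsupp d y \<and> mat_vec d A y = g)"

definition qform :: "nat \<Rightarrow> rmat \<Rightarrow> rvec \<Rightarrow> real" where
  "qform d A v = (\<Sum>i<d. \<Sum>j<d. v i * A i j * v j)"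

definition proj :: "nat \<Rightarrow> real \<Rightarrow> rmat \<Rightarrow> rvec \<Rightarrow> rvec" where
  "proj d B A w = (SOME z. z \<in> domD d B \<and>
     (\<forall>z'\<in>domD d B. qform d A (\<lambda>i. w i - z i) \<le> qform d A (\<lambda>i. w i - z' i)))"

text \<open>One ONS step with parameter beta: given A_{tau-1}, z_tau and the gradient
  gz = grad h_tau(z_tau), returns (A_tau, z_{tau+1}).\<close>
definition ons_step :: "nat \<Rightarrow> real \<Rightarrow> real \<Rightarrow> rmat \<Rightarrow> rvec \<Rightarrow> rvec \<Rightarrow> rmat \<times> rvec" where
  "ons_step d B \<beta> A z gz =
     (let A' = (\<lambda>i j. A i j + gz i * gz j);
          w = (\<lambda>i. z i - (1 / \<beta>) * minv_apply d A' gz i)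
      in (A', proj d B A' w))"

definition flh_gamma :: "nat \<Rightarrow> real \<Rightarrow> real \<Rightarrow> real \<Rightarrow> real" where
  "flh_gamma d B G \<alpha> = 2 * G * B * sqrt (\<alpha> * real d / 2) + 1 / sqrt (2 * \<alpha>)"

definition flh_zeta :: "nat \<Rightarrow> real \<Rightarrow> real \<Rightarrow> real \<Rightarrow> real" where
  "flh_zeta d B G \<alpha> = min (1 / (16 * G * B * sqrt (real d))) (1 / (4 * (flh_gamma d B G \<alpha>)\<^sup>2))"

definition flh_eta :: "nat \<Rightarrow> real \<Rightarrow> real \<Rightarrow> real \<Rightarrow> real" where
  "flh_eta d B G \<alpha> = 1 / (2 * (flh_gamma d B G \<alpha>)\<^sup>2)"

text \<open>epsilon = 1/(beta^2 D_0^2), D_0 = 2 B sqrt d, with beta = zeta.\<close>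
definition flh_eps :: "nat \<Rightarrow> real \<Rightarrow> real \<Rightarrow> real \<Rightarrow> real" where
  "flh_eps d B G \<alpha> = 1 / ((flh_zeta d B G \<alpha>)\<^sup>2 * (2 * B * sqrt (real d))\<^sup>2)"

text \<open>Surrogate loss f_t(x) built from the gradient g = grad l_t(x_t) at the
  prediction xt, and its gradient (computed in closed form).\<close>
definition surr :: "nat \<Rightarrow> real \<Rightarrow> rvec \<Rightarrow> rvec \<Rightarrow> rvec \<Rightarrow> real" where
  "surr d \<alpha> g xt x = (sqrt (\<alpha> / 2) * dotp d g (\<lambda>i. x i - xt i) + 1 / sqrt (2 * \<alpha>))\<^sup>2"

definition surr_grad :: "nat \<Rightarrow> real \<Rightarrow> rvec \<Rightarrow> rvec \<Rightarrow> rvec \<Rightarrow> rvec" where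
  "surr_grad d \<alpha> g xt x = (\<lambda>i. 2 * (sqrt (\<alpha> / 2) * dotp d g (\<lambda>k. x k - xt k) + 1 / sqrt (2 * \<alpha>))
                                 * sqrt (\<alpha> / 2) * g i)"

text \<open>State of FLH-ONS: for each base learner j its current point x^{(j)},
  its current ONS matrix A, and the meta weights v.  flh_state ... t is the state
  at the beginning of round t+1.  Base learner j is started at round j with
  point z1 and matrix epsilon I; entries for j not yet started keep these
  initial values.  gr t x is the gradient of l_t at x.\<close>
type_synonym flh_st = "(nat \<Rightarrow> rvec) \<times> (nat \<Rightarrow> rmat) \<times> (nat \<Rightarrow> real)"

primrec flh_state :: "nat \<Rightarrow> real \<Rightarrow> real \<Rightarrow> real \<Rightarrow> rvec \<Rightarrow> (nat \<Rightarrow> rvec \<Rightarrow> rvec) \<Rightarrow> nat \<Rightarrow> flh_st"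
  where
  "flh_state d B G \<alpha> z1 gr 0 =
     ((\<lambda>j. z1), (\<lambda>j i k. if i = k then flh_eps d B G \<alpha> else 0), (\<lambda>j. if j = 1 then 1 else 0))"
| "flh_state d B G \<alpha> z1 gr (Suc t) =
     (case flh_state d B G \<alpha> z1 gr t of (Z, A, v) \<Rightarrow>
       (let \<tau> = Suc t;
            x = (\<lambda>i. \<Sum>j\<in>{1..\<tau>}. v j * Z j i);
            g = gr \<tau> x;
            \<eta> = flh_eta d B G \<alpha>;
            \<zeta> = flh_zeta d B G \<alpha>;
            upd = (\<lambda>j. ons_step d B \<zeta> (A j) (Z j) (surr_grad d \<alpha> g x (Z j)));
            W = (\<Sum>j\<in>{1..\<tau>}. v j * exp (- \<eta> * surr d \<alpha> g x (Z j)))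
        in ((\<lambda>j. if j \<le> \<tau> then snd (upd j) else Z j),
            (\<lambda>j. if j \<le> \<tau> then fst (upd j) else A j),
            (\<lambda>j. if j \<le> \<tau> then (1 - 1 / real (\<tau> + 1)) * (v j * exp (- \<eta> * surr d \<alpha> g x (Z j)) / W)
                 else if j = \<tau> + 1 then 1 / real (\<tau> + 1) else 0))))"

definition flh_pred :: "nat \<Rightarrow> real \<Rightarrow> real \<Rightarrow> real \<Rightarrow> rvec \<Rightarrow> (nat \<Rightarrow> rvec \<Rightarrow> rvec) \<Rightarrow> nat \<Rightarrow> rvec" where
  "flh_pred d B G \<alpha> z1 gr t =
     (case flh_state d B G \<alpha> z1 gr (t - 1) of (Z, A, v) \<Rightarrow> (\<lambda>i. \<Sum>j\<in>{1..t}. v j * Z j i))"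

definition comparators :: "nat \<Rightarrow> real \<Rightarrow> nat \<Rightarrow> real \<Rightarrow> (nat \<Rightarrow> rvec) set" where
  "comparators d B n C = {w. (\<forall>t\<in>{1..n}. w t \<in> domD d B) \<and>
      (\<Sum>t\<in>{2..n}. norm1 d (\<lambda>i. w t i - w (t - 1) i)) \<le> C}"

definition dyn_regret :: "nat \<Rightarrow> real \<Rightarrow> nat \<Rightarrow> real \<Rightarrow> (nat \<Rightarrow> rvec \<Rightarrow> real) \<Rightarrow> (nat \<Rightarrow> rvec) \<Rightarrow> real" where
  "dyn_regret d B n C L x = Sup ((\<lambda>w. \<Sum>t\<in>{1..n}. L t (x t) - L t (w t)) ` comparators d B n C)"

end

theory Submission
  imports Defs "HOL-Analysis.Analysis"
begin

text \<open>
  Assumption B1 says that the loss gap is at most the surrogate gap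
  \<open>f\<^sub>t(x\<^sub>t) - f\<^sub>t(w)\<close>. The surrogates are squares of affine functions bounded by \<open>\<gamma>\<close>,
  hence exp-concave, and FLH over ONS has regret \<open>O(d (G\<^sup>2B\<^sup>2\<alpha>d + 1/\<alpha>) log n)\<close> on every interval
  against every fixed point of the box. A comparator sequence with \<open>k\<close> switches therefore
  costs \<open>k + 1\<close> times this amount.

  An arbitrary comparator sequence of path length \<open>C\<close> is reduced to a piecewise constant one by
  unbiased randomized rounding to a grid of width \<open>s\<close>. Since the rounding is unbiased, the linear part
  of each surrogate contributes nothing in expectation and the quadratic part contributes
  \<open>O(\<alpha>G\<^sup>2d s\<^sup>2)\<close> per round, while the expected number of switches is at most \<open>C/s\<close>. Taking
  \<open>s\<close> of order \<open>(C/n)\<^bsup>1/3\<^esup>\<close>, or \<open>n\<^bsup>-1/2\<^esup>\<close> if \<open>C \<le> 1/n\<close>, balances the two costs. No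
  optimality conditions for the comparators are needed.
\<close>

section \<open>Quadratic forms and projections\<close>

lemma vsupp_eqI:
  assumes "vsupp d x" "vsupp d y" "\<And>i. i < d \<Longrightarrow> x i = y i"
  shows "x = y"
proof
  fix i show "x i = y i"
    using assms by (cases "i < d") (auto simp: vsupp_def)
qed

lemma dotp_add_right: "dotp d g (\<lambda>i. x i + y i) = dotp d g x + dotp d g y"
  by (simp add: dotp_def algebra_simps sum.distrib)

lemma dotp_diff_right: "dotp d g (\<lambda>i. x i - y i) = dotp d g x - dotp d g y"
  by (simp add: dotp_def algebra_simps sum_subtractf)

lemma dotp_scale_right: "dotp d g (\<lambda>i. c * x i) = c * dotp d g x"
  by (simp add: dotp_def sum_distrib_left mult_ac)

lemma dotp_scale_left: "dotp d (\<lambda>i. c * g i) x = c * dotp d g x"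
  by (simp add: dotp_def sum_distrib_left mult_ac)

lemma dotp_commute: "dotp d x y = dotp d y x"
  by (simp add: dotp_def mult_ac)

lemma dotp_self_nonneg: "dotp d x x \<ge> 0"
  by (simp add: dotp_def sum_nonneg)

lemma dotp_sum_right: "dotp d g (\<lambda>i. \<Sum>j\<in>J. v j * x j i) = (\<Sum>j\<in>J. v j * dotp d g (x j))"
proof -
  have "dotp d g (\<lambda>i. \<Sum>j\<in>J. v j * x j i) = (\<Sum>i<d. \<Sum>j\<in>J. v j * (g i * x j i))"
    by (simp add: dotp_def sum_distrib_left mult_ac)
  also have "\<dots> = (\<Sum>j\<in>J. \<Sum>i<d. v j * (g i * x j i))"
    by (rule sum.swap)
  finally show ?thesis
    by (simp add: dotp_def sum_distrib_left)
qed

lemma dotp_cauchy_schwarz: "(dotp d x y)\<^sup>2 \<le> dotp d x x * dotp d y y"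
  unfolding dotp_def using Cauchy_Schwarz_ineq_sum[of x y "{..<d}"]
  by (simp add: power2_eq_square)

lemma mat_vec_vsupp: "vsupp d (mat_vec d A y)"
  by (simp add: vsupp_def mat_vec_def)

lemma qform_eq_dotp: "qform d A v = dotp d v (mat_vec d A v)"
  by (simp add: qform_def dotp_def mat_vec_def sum_distrib_left mult_ac)

lemma mat_vec_rank_one:
  "i < d \<Longrightarrow> mat_vec d (\<lambda>i j. A i j + g i * g j) y i = mat_vec d A y i + g i * dotp d g y"
  by (simp add: mat_vec_def dotp_def algebra_simps sum.distrib sum_distrib_left)

lemma qform_rank_one:
  "qform d (\<lambda>i j. A i j + g i * g j) v = qform d A v + (dotp d g v)\<^sup>2"
proof -
  have "(\<Sum>i<d. \<Sum>j<d. v i * (g i * g j) * v j) = (dotp d g v)\<^sup>2"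
    by (simp add: dotp_def power2_eq_square sum_product mult_ac)
  then show ?thesis
    by (simp add: qform_def algebra_simps sum.distrib)
qed

lemma qform_scaled_id:
  "qform d (\<lambda>i j. if i = j then e else 0) v = e * dotp d v v"
proof -
  have "(\<Sum>j<d. v i * (if i = j then e else 0) * v j) = e * (v i * v i)" if "i < d" for i
  proof -
    have "(\<Sum>j<d. v i * (if i = j then e else 0) * v j) = (\<Sum>j<d. if i = j then e * (v i * v i) else 0)"
      by (rule sum.cong) auto
    then show ?thesis using that by simp
  qed
  then show ?thesis
    by (simp add: qform_def dotp_def sum_distrib_left)
qed

definition sym_mat :: "nat \<Rightarrow> rmat \<Rightarrow> bool" where
  "sym_mat d A \<longleftrightarrow> (\<forall>i<d. \<forall>j<d. A i j = A j i)"

text \<open>Solvability stands in for invertibility: it is exactly what makes the choice in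
  \<open>minv_apply\<close> well founded. All three conditions survive rank-one updates, so every
  ONS matrix satisfies them.\<close>

definition regular_psd :: "nat \<Rightarrow> rmat \<Rightarrow> bool" where
  "regular_psd d A \<longleftrightarrow> sym_mat d A \<and> (\<forall>x. 0 \<le> qform d A x) \<and>
     (\<forall>g. vsupp d g \<longrightarrow> (\<exists>y. vsupp d y \<and> mat_vec d A y = g))"

lemma dotp_mat_vec_swap:
  assumes "sym_mat d A"
  shows "dotp d x (mat_vec d A y) = dotp d y (mat_vec d A x)"
proof -
  have "dotp d x (mat_vec d A y) = (\<Sum>i<d. \<Sum>j<d. x i * A i j * y j)"
    by (simp add: dotp_def mat_vec_def sum_distrib_left mult_ac)
  also have "\<dots> = (\<Sum>j<d. \<Sum>i<d. x i * A i j * y j)"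
    by (rule sum.swap)
  also have "\<dots> = (\<Sum>j<d. \<Sum>i<d. y j * A j i * x i)"
    using assms by (intro sum.cong refl) (auto simp: sym_mat_def)
  also have "\<dots> = dotp d y (mat_vec d A x)"
    by (simp add: dotp_def mat_vec_def sum_distrib_left mult_ac)
  finally show ?thesis .
qed

lemma mat_vec_lin:
  "mat_vec d A (\<lambda>i. x i + c * y i) = (\<lambda>i. mat_vec d A x i + c * mat_vec d A y i)"
  by (rule ext) (simp add: mat_vec_def algebra_simps sum.distrib sum_distrib_left)

lemma qform_add_scale:
  assumes "sym_mat d A"
  shows "qform d A (\<lambda>i. x i + c * y i) =
    qform d A x + 2 * c * dotp d y (mat_vec d A x) + c\<^sup>2 * qform d A y"
proof -
  have "dotp d (\<lambda>i. x i + c * y i) z = dotp d x z + c * dotp d y z" for z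
    using dotp_commute[of d _ z] by (simp add: dotp_add_right dotp_scale_right)
  then show ?thesis
    unfolding qform_eq_dotp mat_vec_lin
    using dotp_mat_vec_swap[OF assms, of x y]
    by (simp add: dotp_add_right dotp_scale_right algebra_simps power2_eq_square)
qed

lemma regular_psd_scaled_id:
  assumes "e > 0"
  shows "regular_psd d (\<lambda>i j. if i = j then e else 0)"
  unfolding regular_psd_def
proof (intro conjI allI impI)
  show "sym_mat d (\<lambda>i j. if i = j then e else 0)"
    by (auto simp: sym_mat_def)
  show "0 \<le> qform d (\<lambda>i j. if i = j then e else 0) x" for x
    using assms by (simp add: qform_scaled_id dotp_self_nonneg)
  fix g assume g: "vsupp d g"
  have "mat_vec d (\<lambda>i j. if i = j then e else 0) (\<lambda>i. g i / e) i = g i" for i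
  proof (cases "i < d")
    case True
    have "(\<Sum>j<d. (if i = j then e else 0) * (g j / e)) = (\<Sum>j<d. if i = j then g i else 0)"
      using assms by (intro sum.cong) auto
    with True show ?thesis by (simp add: mat_vec_def)
  qed (use g in \<open>simp add: mat_vec_def vsupp_def\<close>)
  then show "\<exists>y. vsupp d y \<and> mat_vec d (\<lambda>i j. if i = j then e else 0) y = g"
    using g by (intro exI[of _ "\<lambda>i. g i / e"]) (auto simp: vsupp_def)
qed

text \<open>The solution is the one given by the Sherman--Morrison formula.\<close>
lemma regular_psd_rank_one:
  assumes A: "regular_psd d A" and g: "vsupp d g"
  shows "regular_psd d (\<lambda>i j. A i j + g i * g j)"
  unfolding regular_psd_def
proof (intro conjI allI impI)
  show "sym_mat d (\<lambda>i j. A i j + g i * g j)"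
    using A by (auto simp: regular_psd_def sym_mat_def)
  show "0 \<le> qform d (\<lambda>i j. A i j + g i * g j) x" for x
    using A by (simp add: qform_rank_one regular_psd_def)
  fix v assume v: "vsupp d v"
  obtain p where p: "vsupp d p" "mat_vec d A p = g"
    using A g by (auto simp: regular_psd_def)
  obtain q where q: "vsupp d q" "mat_vec d A q = v"
    using A v by (auto simp: regular_psd_def)
  have "dotp d g p = qform d A p"
    using p by (simp add: qform_eq_dotp dotp_commute)
  then have pos: "1 + dotp d g p > 0"
    using A by (simp add: regular_psd_def add_pos_nonneg)
  define c where "c = dotp d g q / (1 + dotp d g p)"
  define y where "y = (\<lambda>i. q i + (- c) * p i)"
  have gy: "dotp d g y = c"
  proof -
    have "dotp d g y = dotp d g q + (- c) * dotp d g p"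
      unfolding y_def by (simp add: dotp_add_right dotp_diff_right dotp_scale_right)
    moreover have "dotp d g q = c * (1 + dotp d g p)"
      using pos by (simp add: c_def)
    ultimately show ?thesis by (simp add: algebra_simps)
  qed
  have "mat_vec d (\<lambda>i j. A i j + g i * g j) y = v"
  proof (rule vsupp_eqI[OF mat_vec_vsupp v])
    fix i assume "i < d"
    have "mat_vec d A y i = v i - c * g i"
      unfolding y_def mat_vec_lin using p q by simp
    with \<open>i < d\<close> gy show "mat_vec d (\<lambda>i j. A i j + g i * g j) y i = v i"
      by (simp add: mat_vec_rank_one)
  qed
  moreover have "vsupp d y"
    using p q by (simp add: y_def vsupp_def)
  ultimately show "\<exists>y. vsupp d y \<and> mat_vec d (\<lambda>i j. A i j + g i * g j) y = v"
    by blast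
qed

lemma minv_apply_solves:
  assumes "regular_psd d A" "vsupp d g"
  shows "vsupp d (minv_apply d A g)" "mat_vec d A (minv_apply d A g) = g"
proof -
  have "\<exists>y. vsupp d y \<and> mat_vec d A y = g"
    using assms by (auto simp: regular_psd_def)
  then have "vsupp d (minv_apply d A g) \<and> mat_vec d A (minv_apply d A g) = g"
    unfolding minv_apply_def by (rule someI_ex)
  then show "vsupp d (minv_apply d A g)" "mat_vec d A (minv_apply d A g) = g"
    by auto
qed

section \<open>The box and the projection in a quadratic form\<close>

lemma compact_domD: "compact (domD d B)"
proof -
  \<comment> \<open>Written as a product over all of \<open>nat\<close>, with factor
    \<open>{0}\<close> from index \<open>d\<close> on, the box is compact by Tychonoff's
    theorem.\<close>
  have eq: "domD d B = (\<Pi>\<^sub>E i\<in>UNIV. if i < d then {-B..B} else {0})"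
  proof (rule set_eqI)
    fix x :: rvec
    have "x \<in> domD d B \<longleftrightarrow> (\<forall>i. x i \<in> (if i < d then {-B..B} else {0}))"
      unfolding domD_def vsupp_def by (simp add: abs_le_iff) (metis leD leI minus_le_iff)
    then show "x \<in> domD d B \<longleftrightarrow> x \<in> (\<Pi>\<^sub>E i\<in>UNIV. if i < d then {-B..B} else {0})"
      by (simp only: PiE_UNIV_domain Pi_iff UNIV_I True_implies_equals simp_thms ball_UNIV)
  qed
  have "compactin (product_topology (\<lambda>i. euclidean) UNIV)
      (\<Pi>\<^sub>E i\<in>(UNIV :: nat set). if i < d then {-B..B} else {0::real})"
    by (subst compactin_PiE) auto
  then show ?thesis
    by (simp add: eq euclidean_product_topology)
qed

lemma continuous_on_qform_diff: "continuous_on S (\<lambda>z. qform d A (\<lambda>i. w i - z i))"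
proof -
  have "continuous_on S (\<lambda>z::rvec. z i)" for i
    by (rule continuous_on_subset[OF continuous_on_product_coordinates]) simp
  then show ?thesis
    unfolding qform_def by (intro continuous_intros)
qed

text \<open>A continuous function attains its minimum on a compact set, so the choice in
  \<open>proj\<close> is a genuine minimizer. The point \<open>z1\<close> witnesses that the box is
  nonempty.\<close>

lemma proj_minimizes:
  assumes "z1 \<in> domD d B"
  shows "proj d B A w \<in> domD d B"
    "z' \<in> domD d B \<Longrightarrow> qform d A (\<lambda>i. w i - proj d B A w i) \<le> qform d A (\<lambda>i. w i - z' i)"
proof -
  obtain z where "z \<in> domD d B"
    "\<And>z'. z' \<in> domD d B \<Longrightarrow> qform d A (\<lambda>i. w i - z i) \<le> qform d A (\<lambda>i. w i - z' i)"
    using continuous_attains_inf[OF compact_domD _ continuous_on_qform_diff, of d B d A w] assms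
    by blast
  then have "\<exists>z. z \<in> domD d B \<and>
     (\<forall>z'\<in>domD d B. qform d A (\<lambda>i. w i - z i) \<le> qform d A (\<lambda>i. w i - z' i))" by blast
  from someI_ex[OF this]
  show "proj d B A w \<in> domD d B"
    "z' \<in> domD d B \<Longrightarrow> qform d A (\<lambda>i. w i - proj d B A w i) \<le> qform d A (\<lambda>i. w i - z' i)"
    unfolding proj_def by auto
qed

lemma domD_segment:
  assumes x: "x \<in> domD d B" and y: "y \<in> domD d B" and s: "0 \<le> s" "s \<le> 1"
  shows "(\<lambda>i. x i + s * (y i - x i)) \<in> domD d B"
proof -
  have "\<bar>x i + s * (y i - x i)\<bar> \<le> B" if "i < d" for i
  proof -
    have "x i + s * (y i - x i) = (1 - s) * x i + s * y i" by (simp add: algebra_simps)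
    also have "\<bar>\<dots>\<bar> \<le> (1 - s) * \<bar>x i\<bar> + s * \<bar>y i\<bar>"
      using s by (intro order_trans[OF abs_triangle_ineq]) (simp add: abs_mult)
    also have "\<dots> \<le> (1 - s) * B + s * B"
      using that x y s by (intro add_mono mult_left_mono) (auto simp: domD_def)
    finally show ?thesis by (simp add: algebra_simps)
  qed
  then show ?thesis using x y by (auto simp: domD_def vsupp_def)
qed

text \<open>First-order optimality: moving a fraction \<open>s\<close> from the projection
  \<open>z\<close> towards \<open>u\<close> cannot lower the form, which forces the cross term
  \<open>P\<close> to be nonnegative. Expanding the form around \<open>z\<close> then gives the
  inequality.\<close>

lemma proj_pythagoras:
  assumes A: "regular_psd d A" and u: "u \<in> domD d B"
  shows "qform d A (\<lambda>i. proj d B A w i - u i) \<le> qform d A (\<lambda>i. w i - u i)"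
proof -
  define z where "z = proj d B A w"
  have z: "z \<in> domD d B" unfolding z_def by (rule proj_minimizes[OF u])
  have sym: "sym_mat d A" and psd: "\<And>x. 0 \<le> qform d A x"
    using A by (auto simp: regular_psd_def)
  define a where "a = (\<lambda>i. w i - z i)"
  define b where "b = (\<lambda>i. z i - u i)"
  define P where "P = dotp d b (mat_vec d A a)"
  have step: "0 \<le> 2 * P + s * qform d A b" if s: "0 < s" "s \<le> 1" for s
  proof -
    have "qform d A a \<le> qform d A (\<lambda>i. w i - (z i + s * (u i - z i)))"
      unfolding a_def z_def
      using proj_minimizes(2)[OF u domD_segment[OF z u, of s]] s by (simp add: z_def)
    also have "(\<lambda>i. w i - (z i + s * (u i - z i))) = (\<lambda>i. a i + s * b i)"
      by (auto simp: a_def b_def algebra_simps)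
    also have "qform d A (\<lambda>i. a i + s * b i) = qform d A a + 2 * s * P + s\<^sup>2 * qform d A b"
      unfolding P_def by (rule qform_add_scale[OF sym])
    finally have "0 \<le> s * (2 * P + s * qform d A b)"
      by (simp add: algebra_simps power2_eq_square)
    with s show ?thesis by (simp add: zero_le_mult_iff)
  qed
  have "P \<ge> 0"
  proof (rule ccontr)
    assume "\<not> P \<ge> 0"
    then have P: "P < 0" by simp
    \<comment> \<open>Small enough that \<open>s * qform d A b \<le> - P\<close>, which makes the
      right-hand side of \<open>step\<close> at most \<open>P < 0\<close>. The summand 1 in the
      denominator guards against \<open>qform d A b = 0\<close>.\<close>
    define s where "s = min 1 (- P / (1 + qform d A b))"
    have q: "0 \<le> qform d A b" by (rule psd)
    have "0 < - P / (1 + qform d A b)" using P q by (intro divide_pos_pos) auto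
    then have s: "0 < s" "s \<le> 1" by (auto simp: s_def)
    have "s * qform d A b \<le> s * (1 + qform d A b)" using s by (simp add: algebra_simps)
    also have "\<dots> \<le> (- P / (1 + qform d A b)) * (1 + qform d A b)"
      using q by (intro mult_right_mono) (auto simp: s_def)
    also have "\<dots> = - P" using q by simp
    finally show False using step[OF s] P by linarith
  qed
  have "(\<lambda>i. w i - u i) = (\<lambda>i. a i + 1 * b i)" by (auto simp: a_def b_def)
  then have "qform d A (\<lambda>i. w i - u i) = qform d A a + 2 * P + qform d A b"
    using qform_add_scale[OF sym, of a 1 b] by (simp add: P_def)
  with \<open>P \<ge> 0\<close> psd[of a] show ?thesis
    by (simp add: b_def z_def)
qed

text \<open>Projecting \<open>w\<close> cannot increase the \<open>A'\<close>-distance to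
  \<open>u\<close>. Since \<open>A'\<close> maps the Newton direction to \<open>gz\<close>,
  expanding the distance of \<open>w\<close> to \<open>u\<close> produces the linear term in
  \<open>gz\<close> and the local norm of the gradient.\<close>

lemma ons_step_regret:
  fixes z :: rvec
  assumes A: "regular_psd d A" and gz: "vsupp d gz" and u: "u \<in> domD d B" and \<beta>: "\<beta> > 0"
  defines "A' \<equiv> fst (ons_step d B \<beta> A z gz)" and "z' \<equiv> snd (ons_step d B \<beta> A z gz)"
  shows "dotp d gz (\<lambda>i. z i - u i) \<le> 1 / (2 * \<beta>) * dotp d gz (minv_apply d A' gz)
     + \<beta> / 2 * (qform d A' (\<lambda>i. z i - u i) - qform d A' (\<lambda>i. z' i - u i))"
proof -
  have A'_eq: "A' = (\<lambda>i j. A i j + gz i * gz j)"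
    by (simp add: A'_def ons_step_def Let_def)
  have A': "regular_psd d A'" unfolding A'_eq by (rule regular_psd_rank_one[OF A gz])
  define y where "y = minv_apply d A' gz"
  have y: "mat_vec d A' y = gz" unfolding y_def by (rule minv_apply_solves[OF A' gz])
  define w where "w = (\<lambda>i. z i - (1 / \<beta>) * y i)"
  have z'_eq: "z' = proj d B A' w"
    by (simp add: z'_def ons_step_def Let_def w_def y_def A'_eq)
  have sym: "sym_mat d A'" using A' by (simp add: regular_psd_def)
  have "qform d A' (\<lambda>i. z' i - u i) \<le> qform d A' (\<lambda>i. w i - u i)"
    unfolding z'_eq by (rule proj_pythagoras[OF A' u])
  also have "(\<lambda>i. w i - u i) = (\<lambda>i. (z i - u i) + (- (1 / \<beta>)) * y i)"
    by (auto simp: w_def)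
  also have "qform d A' \<dots> = qform d A' (\<lambda>i. z i - u i)
      + 2 * (- (1 / \<beta>)) * dotp d y (mat_vec d A' (\<lambda>i. z i - u i))
      + (- (1 / \<beta>))\<^sup>2 * qform d A' y"
    by (rule qform_add_scale[OF sym])
  also have "dotp d y (mat_vec d A' (\<lambda>i. z i - u i)) = dotp d gz (\<lambda>i. z i - u i)"
    using dotp_mat_vec_swap[OF sym, of y "\<lambda>i. z i - u i"] y by (simp add: dotp_commute)
  also have "qform d A' y = dotp d gz y"
    by (simp add: qform_eq_dotp y dotp_commute)
  finally have "2 / \<beta> * dotp d gz (\<lambda>i. z i - u i) \<le> (1 / \<beta>)\<^sup>2 * dotp d gz y +
      (qform d A' (\<lambda>i. z i - u i) - qform d A' (\<lambda>i. z' i - u i))"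
    by simp
  then have "\<beta> / 2 * (2 / \<beta> * dotp d gz (\<lambda>i. z i - u i)) \<le> \<beta> / 2 * ((1 / \<beta>)\<^sup>2 * dotp d gz y +
      (qform d A' (\<lambda>i. z i - u i) - qform d A' (\<lambda>i. z' i - u i)))"
    using \<beta> by (intro mult_left_mono) auto
  moreover have "\<beta> / 2 * ((1 / \<beta>)\<^sup>2 * p + q) = 1 / (2 * \<beta>) * p + \<beta> / 2 * q" for p q
    using \<beta> by (simp add: power2_eq_square field_simps)
  ultimately show ?thesis
    using \<beta> by (simp add: y_def)
qed

section \<open>Online Newton steps\<close>

text \<open>The recurrence is assumed only for indices below \<open>d\<close>, so that the lemma
  also applies to the Schur complements of the induction on the dimension, which are controlled only
  there.\<close>

lemma qform_rank_one_seq_ge: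
  assumes "\<And>i j. i < d \<Longrightarrow> j < d \<Longrightarrow> A 0 i j = (if i = j then e else 0)"
    and "\<And>t i j. t < n \<Longrightarrow> i < d \<Longrightarrow> j < d \<Longrightarrow> A (Suc t) i j = A t i j + g t i * g t j"
    and "t \<le> n"
  shows "e * dotp d v v \<le> qform d (A t) v"
  using assms(3)
proof (induction t)
  case 0
  have "qform d (A 0) v = qform d (\<lambda>i j. if i = j then e else 0) v"
    unfolding qform_def using assms(1) by (intro sum.cong) auto
  then show ?case by (simp add: qform_scaled_id)
next
  case (Suc t)
  have "qform d (A (Suc t)) v = qform d (\<lambda>i j. A t i j + g t i * g t j) v"
    unfolding qform_def using assms(2) Suc.prems by (intro sum.cong) auto
  then show ?case using Suc by (simp add: qform_rank_one add_increasing2)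
qed

lemma diag_rank_one_seq_ge:
  assumes "\<And>i j. i < d \<Longrightarrow> j < d \<Longrightarrow> A 0 i j = (if i = j then e else 0)"
    and "\<And>t i j. t < n \<Longrightarrow> i < d \<Longrightarrow> j < d \<Longrightarrow> A (Suc t) i j = A t i j + g t i * g t j"
    and "i < d" "t \<le> n"
  shows "e \<le> (A t i i :: real)"
  using assms(4)
proof (induction t)
  case 0
  then show ?case using assms(1,3) by simp
next
  case (Suc t)
  then have "A (Suc t) i i = A t i i + g t i * g t i" using assms(2,3) by simp
  then show ?case using Suc by (simp add: add_increasing2)
qed

text \<open>This is \<open>ln z \<le> z - 1\<close> at \<open>z = a / b\<close>. It makes the scalar
  terms split off in the elliptical potential telescope.\<close>

lemma diff_div_le_ln: 
  assumes "0 < a" "a \<le> (b::real)"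
  shows "(b - a) / b \<le> ln b - ln a"
proof -
  have "ln (a / b) \<le> a / b - 1" using assms by (intro ln_le_minus_one) auto
  then show ?thesis using assms by (simp add: ln_div diff_divide_distrib)
qed

text \<open>Entry by entry, the Schur complement with respect to the pivot \<open>a\<close> again
  changes by a product of two residuals. Distributing the factor \<open>a' / a\<close> as two square
  roots gives both residuals the same shape, so the update is a symmetric rank-one update.\<close>

lemma schur_rank_one:
  fixes a b c p q :: real
  assumes "a > 0"
  defines "a' \<equiv> a + p * p"
  shows "(q + g * h) - (b + g * p) * (c + h * p) / a' =
    (q - b * c / a) + sqrt (a' / a) * (g - (b + g * p) * p / a') * (sqrt (a' / a) * (h - (c + h * p) * p / a'))"
proof -
  have a': "a' > 0" using assms by (simp add: add_pos_nonneg)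
  have X: "g - (b + g * p) * p / a' = (g * a - b * p) / a'"
    using a' by (simp add: field_simps) (simp add: a'_def algebra_simps)
  have Y: "h - (c + h * p) * p / a' = (h * a - c * p) / a'"
    using a' by (simp add: field_simps) (simp add: a'_def algebra_simps)
  have sq: "sqrt (a' / a) * x * (sqrt (a' / a) * y) = a' / a * (x * y)" for x y
  proof -
    have "sqrt (a' / a) * x * (sqrt (a' / a) * y) = (sqrt (a' / a) * sqrt (a' / a)) * (x * y)"
      by (simp only: mult_ac)
    also have "sqrt (a' / a) * sqrt (a' / a) = a' / a"
      using assms(1) a' by (intro real_sqrt_mult_self[THEN trans]) simp
    finally show ?thesis .
  qed
  have "a' / a * ((g * a - b * p) / a' * ((h * a - c * p) / a')) = (g * a - b * p) * (h * a - c * p) / (a * a')"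
    using a' by simp
  moreover have "(g * a - b * p) * (h * a - c * p) = a * a' * (g * h) - a * ((b + g * p) * (c + h * p)) + a' * (b * c)"
    by (simp add: a'_def algebra_simps)
  ultimately show ?thesis
    unfolding sq X Y using a' assms(1) by (simp add: add_divide_distrib diff_divide_distrib)
qed

text \<open>Induction on the dimension: eliminating the last coordinate replaces the matrices by their
  Schur complements, which again evolve by rank-one updates, and splits off a scalar sum
  that telescopes under the logarithm. This avoids determinants.\<close>
lemma elliptical_potential:
  fixes A :: "nat \<Rightarrow> rmat" and g y :: "nat \<Rightarrow> rvec"
  assumes "e > 0"
    and "\<And>i j. i < d \<Longrightarrow> j < d \<Longrightarrow> A 0 i j = (if i = j then e else 0)"
    and "\<And>t i j. t < n \<Longrightarrow> i < d \<Longrightarrow> j < d \<Longrightarrow> A (Suc t) i j = A t i j + g t i * g t j"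
    and "\<And>t i. t < n \<Longrightarrow> i < d \<Longrightarrow> (\<Sum>j<d. A (Suc t) i j * y t j) = g t i"
  shows "(\<Sum>t<n. dotp d (g t) (y t)) \<le> (\<Sum>i<d. ln (A n i i / e))"
  using assms(2-)
proof (induction d arbitrary: A g y)
  case 0
  then show ?case by (simp add: dotp_def)
next
  case (Suc d)
  note A0 = Suc.prems(1) and AS = Suc.prems(2) and sol = Suc.prems(3)
  define a where "a = (\<lambda>t. A t d d)"
  define S where "S = (\<lambda>t i j. A t i j - A t i d * A t j d / a t)"
  \<comment> \<open>\<open>r\<close> is the right-hand side of the linear system reduced to the
    first \<open>d\<close> coordinates, which \<open>y\<close> solves. The Schur complements,
    however, are updated by \<open>k t * r t\<close>, so the induction hypothesis is applied with
    both \<open>r\<close> and \<open>y\<close> scaled by \<open>k\<close>.\<close>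
  define r where "r = (\<lambda>t i. g t i - A (Suc t) i d * g t d / a (Suc t))"
  define k where "k = (\<lambda>t. sqrt (a (Suc t) / a t))"
  have ae: "e \<le> a t" if "t \<le> n" for t
    unfolding a_def using that by (intro diag_rank_one_seq_ge[OF A0 AS]) auto
  have a_pos: "0 < a t" if "t \<le> n" for t
    using ae[OF that] assms(1) by linarith
  have aS: "a (Suc t) = a t + g t d * g t d" if "t < n" for t
    using AS[OF that, of d d] by (simp add: a_def)
  have sym: "A t i j = A t j i" if "t \<le> n" "i < Suc d" "j < Suc d" for t i j
    using that(1)
  proof (induction t)
    case 0
    then show ?case using A0 that by simp
  next
    case (Suc t)
    then show ?case using AS[of t i j] AS[of t j i] that by simp
  qed
  have S0: "S 0 i j = (if i = j then e else 0)" if "i < d" "j < d" for i j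
    using that A0 by (simp add: S_def)
  have SS: "S (Suc t) i j = S t i j + (k t * r t i) * (k t * r t j)" if "t < n" "i < d" "j < d" for t i j
    using schur_rank_one[of "a t" "A t i j" "g t i" "g t j" "A t i d" "g t d" "A t j d"]
      AS[of t] aS[of t] a_pos[of t] that
    by (simp add: S_def k_def r_def)
  have yd: "a (Suc t) * y t d = g t d - (\<Sum>j<d. A (Suc t) j d * y t j)" if "t < n" for t
  proof -
    have "(\<Sum>j<d. A (Suc t) d j * y t j) = (\<Sum>j<d. A (Suc t) j d * y t j)"
      using sym[of "Suc t" d] that by (intro sum.cong) auto
    then show ?thesis using sol[OF that, of d] by (simp add: a_def)
  qed
  have ydd: "y t d = (g t d - (\<Sum>j<d. A (Suc t) j d * y t j)) / a (Suc t)" if "t < n" for t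
    using yd[OF that] a_pos[of "Suc t"] that by (simp add: field_simps)
  have Sy: "(\<Sum>j<d. S (Suc t) i j * y t j) = r t i" if "t < n" "i < d" for t i
  proof -
    have "(\<Sum>j<d. S (Suc t) i j * y t j) = (\<Sum>j<d. A (Suc t) i j * y t j)
        - A (Suc t) i d / a (Suc t) * (\<Sum>j<d. A (Suc t) j d * y t j)"
      by (simp add: S_def sum_subtractf sum_distrib_left algebra_simps)
    moreover have "(\<Sum>j<d. A (Suc t) i j * y t j) = g t i - A (Suc t) i d * y t d"
      using sol[of t i] that by simp
    moreover have "A (Suc t) i d * y t d = A (Suc t) i d * g t d / a (Suc t)
        - A (Suc t) i d / a (Suc t) * (\<Sum>j<d. A (Suc t) j d * y t j)"
      unfolding ydd[OF that(1)] by (simp add: algebra_simps diff_divide_distrib)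
    ultimately show ?thesis by (simp add: r_def)
  qed
  have split: "dotp (Suc d) (g t) (y t) = dotp d (r t) (y t) + g t d * g t d / a (Suc t)" if "t < n" for t
  proof -
    have "dotp d (r t) (y t) = dotp d (g t) (y t) - g t d / a (Suc t) * (\<Sum>j<d. A (Suc t) j d * y t j)"
      by (simp add: r_def dotp_def sum_subtractf sum_distrib_left algebra_simps)
    moreover have "g t d * y t d = g t d * g t d / a (Suc t) - g t d / a (Suc t) * (\<Sum>j<d. A (Suc t) j d * y t j)"
      unfolding ydd[OF that] by (simp add: algebra_simps diff_divide_distrib)
    ultimately show ?thesis by (simp add: dotp_def)
  qed
  \<comment> \<open>The scaling by \<open>k\<close> errs in the right direction:
    \<open>k t * k t \<ge> 1\<close>, and the unscaled product is a value of a nonnegative quadratic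
    form.\<close>
  have ry: "dotp d (r t) (y t) \<le> dotp d (\<lambda>i. k t * r t i) (\<lambda>i. k t * y t i)" if "t < n" for t
  proof -
    have "dotp d (r t) (y t) = qform d (S (Suc t)) (y t)"
      unfolding qform_eq_dotp dotp_def mat_vec_def using Sy[OF that] by (intro sum.cong) auto
    also have "\<dots> \<ge> e * dotp d (y t) (y t)"
      by (rule qform_rank_one_seq_ge[OF S0 SS]) (use that in auto)
    finally have nn: "0 \<le> dotp d (r t) (y t)"
      using assms(1) dotp_self_nonneg[of d "y t"] by (meson mult_nonneg_nonneg less_imp_le order_trans)
    have "1 \<le> a (Suc t) / a t" using a_pos[of t] aS that by simp
    moreover have "dotp d (\<lambda>i. k t * r t i) (\<lambda>i. k t * y t i) = (k t * k t) * dotp d (r t) (y t)"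
      by (simp add: dotp_scale_left dotp_scale_right)
    moreover have "k t * k t = a (Suc t) / a t"
      using a_pos[of t] a_pos[of "Suc t"] that by (simp add: k_def)
    ultimately show ?thesis using mult_right_mono[OF _ nn, of 1] by (metis mult_1)
  qed
  have IH: "(\<Sum>t<n. dotp d (\<lambda>i. k t * r t i) (\<lambda>i. k t * y t i)) \<le> (\<Sum>i<d. ln (S n i i / e))"
  proof (rule Suc.IH[OF S0 SS])
    fix t i assume ti: "t < n" "i < d"
    have "(\<Sum>j<d. S (Suc t) i j * (k t * y t j)) = k t * (\<Sum>j<d. S (Suc t) i j * y t j)"
      by (simp add: sum_distrib_left mult_ac)
    then show "(\<Sum>j<d. S (Suc t) i j * (k t * y t j)) = k t * r t i" using Sy[OF ti] by simp
  qed
  have diag: "ln (S n i i / e) \<le> ln (A n i i / e)" if "i < d" for i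
  proof -
    have "e \<le> S n i i" by (rule diag_rank_one_seq_ge[OF S0 SS that]) auto
    moreover have "S n i i \<le> A n i i" using a_pos[of n] by (simp add: S_def)
    ultimately show ?thesis using assms(1)
      by (subst ln_le_cancel_iff) (auto intro: divide_right_mono)
  qed
  have scalar: "(\<Sum>t<m. g t d * g t d / a (Suc t)) \<le> ln (a m) - ln (a 0)" if "m \<le> n" for m
    using that
  proof (induction m)
    case (Suc m)
    have "g m d * g m d / a (Suc m) \<le> ln (a (Suc m)) - ln (a m)"
      using diff_div_le_ln[of "a m" "a (Suc m)"] a_pos[of m] aS[of m] Suc.prems by simp
    then show ?case using Suc by simp
  qed simp
  have a0: "a 0 = e" using A0 by (simp add: a_def)
  have "(\<Sum>t<n. dotp (Suc d) (g t) (y t)) =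
      (\<Sum>t<n. dotp d (r t) (y t)) + (\<Sum>t<n. g t d * g t d / a (Suc t))"
    by (simp add: split sum.distrib)
  also have "\<dots> \<le> (\<Sum>t<n. dotp d (\<lambda>i. k t * r t i) (\<lambda>i. k t * y t i)) + (ln (a n) - ln (a 0))"
    using ry scalar by (intro add_mono sum_mono) auto
  also have "\<dots> \<le> (\<Sum>i<d. ln (A n i i / e)) + ln (A n d d / e)"
  proof -
    have "(\<Sum>i<d. ln (S n i i / e)) \<le> (\<Sum>i<d. ln (A n i i / e))"
      using diag by (intro sum_mono) auto
    moreover have "ln (a n) - ln (a 0) = ln (A n d d / e)"
      using a_pos[of n] assms(1) a0 by (simp add: ln_div a_def)
    ultimately show ?thesis using IH by linarith
  qed
  finally show ?case by simp
qed

text \<open>Adding the rank-one term to the matrix raises the squared distance by exactly the square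
  that is subtracted on the left, so the distances telescope. What remains is the elliptical
  potential and the initial distance.\<close>

lemma ons_regret:
  fixes A :: "nat \<Rightarrow> rmat" and Z gz :: "nat \<Rightarrow> rvec"
  assumes e: "e > 0" and \<beta>: "\<beta> > 0" and u: "u \<in> domD d B"
    and A0: "A 0 = (\<lambda>i j. if i = j then e else 0)"
    and step: "\<And>t. t < m \<Longrightarrow> (A (Suc t), Z (Suc t)) = ons_step d B \<beta> (A t) (Z t) (gz t)"
    and gz: "\<And>t. t < m \<Longrightarrow> vsupp d (gz t)"
  shows "(\<Sum>t<m. dotp d (gz t) (\<lambda>i. Z t i - u i) - \<beta> / 2 * (dotp d (gz t) (\<lambda>i. Z t i - u i))\<^sup>2)
    \<le> 1 / (2 * \<beta>) * (\<Sum>i<d. ln (A m i i / e)) + \<beta> / 2 * (e * dotp d (\<lambda>i. Z 0 i - u i) (\<lambda>i. Z 0 i - u i))"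
proof -
  have AS: "A (Suc t) = (\<lambda>i j. A t i j + gz t i * gz t j)" if "t < m" for t
    using step[OF that] by (simp add: ons_step_def Let_def)
  have reg: "regular_psd d (A t)" if "t \<le> m" for t
    using that
  proof (induction t)
    case 0
    then show ?case using A0 regular_psd_scaled_id[OF e] by simp
  next
    case (Suc t)
    then show ?case using AS regular_psd_rank_one[OF _ gz, of "A t" t] by simp
  qed
  define y where "y = (\<lambda>t. minv_apply d (A (Suc t)) (gz t))"
  define q where "q = (\<lambda>t. qform d (A t) (\<lambda>i. Z t i - u i))"
  have one: "dotp d (gz t) (\<lambda>i. Z t i - u i) - \<beta> / 2 * (dotp d (gz t) (\<lambda>i. Z t i - u i))\<^sup>2
     \<le> 1 / (2 * \<beta>) * dotp d (gz t) (y t) + \<beta> / 2 * (q t - q (Suc t))" if "t < m" for t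
  proof -
    have fs: "fst (ons_step d B \<beta> (A t) (Z t) (gz t)) = A (Suc t)"
      "snd (ons_step d B \<beta> (A t) (Z t) (gz t)) = Z (Suc t)"
      using step[OF that] by (metis fst_conv, metis snd_conv)
    have "dotp d (gz t) (\<lambda>i. Z t i - u i) \<le> 1 / (2 * \<beta>) * dotp d (gz t) (y t)
     + \<beta> / 2 * (qform d (A (Suc t)) (\<lambda>i. Z t i - u i) - q (Suc t))"
      using ons_step_regret[OF reg gz u \<beta>, of t t "Z t"] that by (simp add: fs y_def q_def)
    moreover have "qform d (A (Suc t)) (\<lambda>i. Z t i - u i) = q t + (dotp d (gz t) (\<lambda>i. Z t i - u i))\<^sup>2"
      unfolding q_def AS[OF that] by (rule qform_rank_one)
    ultimately show ?thesis by (simp add: algebra_simps)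
  qed
  have "(\<Sum>t<m. dotp d (gz t) (y t)) \<le> (\<Sum>i<d. ln (A m i i / e))"
  proof (rule elliptical_potential[where A = A, OF e])
    fix t i assume ti: "t < m" "i < d"
    have "mat_vec d (A (Suc t)) (y t) i = gz t i"
      unfolding y_def using minv_apply_solves(2)[OF reg gz, of "Suc t" t] ti by simp
    then show "(\<Sum>j<d. A (Suc t) i j * y t j) = gz t i" using ti by (simp add: mat_vec_def)
  qed (auto simp: A0 AS)
  then have 1: "1 / (2 * \<beta>) * (\<Sum>t<m. dotp d (gz t) (y t)) \<le> 1 / (2 * \<beta>) * (\<Sum>i<d. ln (A m i i / e))"
    using \<beta> by (intro mult_left_mono) auto
  have "(\<Sum>t<m. q t - q (Suc t)) = q 0 - q m" by (rule sum_lessThan_telescope')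
  moreover have "q m \<ge> 0" using reg[of m] by (simp add: q_def regular_psd_def)
  moreover have "q 0 = e * dotp d (\<lambda>i. Z 0 i - u i) (\<lambda>i. Z 0 i - u i)"
    by (simp add: q_def A0 qform_scaled_id)
  ultimately have 2: "\<beta> / 2 * (\<Sum>t<m. q t - q (Suc t)) \<le> \<beta> / 2 * (e * dotp d (\<lambda>i. Z 0 i - u i) (\<lambda>i. Z 0 i - u i))"
    using \<beta> by (intro mult_left_mono) auto
  have "(\<Sum>t<m. dotp d (gz t) (\<lambda>i. Z t i - u i) - \<beta> / 2 * (dotp d (gz t) (\<lambda>i. Z t i - u i))\<^sup>2)
    \<le> (\<Sum>t<m. 1 / (2 * \<beta>) * dotp d (gz t) (y t) + \<beta> / 2 * (q t - q (Suc t)))"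
    using one by (intro sum_mono) auto
  also have "\<dots> = 1 / (2 * \<beta>) * (\<Sum>t<m. dotp d (gz t) (y t)) + \<beta> / 2 * (\<Sum>t<m. q t - q (Suc t))"
    by (simp add: sum.distrib sum_distrib_left)
  finally show ?thesis using 1 2 by linarith
qed

section \<open>Regret on intervals\<close>

lemma domD_dist_le:
  assumes "x \<in> domD d B" "y \<in> domD d B"
  shows "dotp d (\<lambda>i. x i - y i) (\<lambda>i. x i - y i) \<le> 4 * B\<^sup>2 * real d"
proof -
  have "dotp d (\<lambda>i. x i - y i) (\<lambda>i. x i - y i) \<le> (\<Sum>i<d. 4 * B\<^sup>2)"
    unfolding dotp_def
  proof (rule sum_mono)
    fix i assume "i \<in> {..<d}"
    then have "\<bar>x i\<bar> \<le> B" "\<bar>y i\<bar> \<le> B" using assms by (auto simp: domD_def)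
    then have "\<bar>x i - y i\<bar> \<le> \<bar>2 * B\<bar>" by linarith
    then have "(x i - y i)\<^sup>2 \<le> (2 * B)\<^sup>2" by (simp only: abs_le_square_iff)
    then show "(x i - y i) * (x i - y i) \<le> 4 * B\<^sup>2" by (simp add: power2_eq_square)
  qed
  then show ?thesis by (simp add: mult_ac)
qed

lemma domD_convex_sum:
  assumes "finite J" "\<And>j. j \<in> J \<Longrightarrow> x j \<in> domD d B" "\<And>j. j \<in> J \<Longrightarrow> 0 \<le> v j" "sum v J = 1"
  shows "(\<lambda>i. \<Sum>j\<in>J. v j * x j i) \<in> domD d B"
proof -
  have "\<bar>\<Sum>j\<in>J. v j * x j i\<bar> \<le> B" if "i < d" for i
  proof -
    have "\<bar>\<Sum>j\<in>J. v j * x j i\<bar> \<le> (\<Sum>j\<in>J. \<bar>v j * x j i\<bar>)" by (rule sum_abs)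
    also have "\<dots> \<le> (\<Sum>j\<in>J. v j * B)"
      using assms that by (intro sum_mono) (auto simp: abs_mult domD_def intro!: mult_left_mono)
    also have "\<dots> = B" using assms(4) by (simp flip: sum_distrib_right)
    finally show ?thesis .
  qed
  then show ?thesis using assms(2) by (auto simp: domD_def vsupp_def)
qed

text \<open>The second derivative has the sign of \<open>2 * k * x\<^sup>2 - 1\<close>, which is
  nonpositive exactly up to \<open>\<bar>x\<bar> = c\<close>. With \<open>c = \<gamma>\<close> the
  rate is the learning rate \<eta>.\<close>

lemma concave_on_exp_neg_square:
  assumes "(c::real) > 0"
  shows "concave_on {-c..c} (\<lambda>x. exp (- (1 / (2 * c\<^sup>2)) * x\<^sup>2))"
proof (rule f''_le0_imp_concave)
  define k where "k = 1 / (2 * c\<^sup>2)"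
  show "convex {-c..c}" by simp
  show "((\<lambda>x. exp (- (1 / (2 * c\<^sup>2)) * x\<^sup>2)) has_real_derivative (- 2 * k * x) * exp (- k * x\<^sup>2)) (at x)" for x
    unfolding k_def[symmetric] by (auto intro!: derivative_eq_intros)
  show "((\<lambda>x. (- 2 * k * x) * exp (- k * x\<^sup>2)) has_real_derivative
      (4 * k\<^sup>2 * x\<^sup>2 - 2 * k) * exp (- k * x\<^sup>2)) (at x)" for x
    by (auto intro!: derivative_eq_intros simp: algebra_simps power2_eq_square)
  fix x assume "x \<in> {-c..c}"
  then have "x\<^sup>2 \<le> c\<^sup>2" by (simp add: abs_le_square_iff[symmetric] abs_le_iff)
  then have "2 * k * x\<^sup>2 \<le> 1" using assms by (simp add: k_def field_simps)
  moreover have "k > 0" using assms by (simp add: k_def)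
  ultimately have "2 * k * (2 * k * x\<^sup>2 - 1) \<le> 0" by (simp add: mult_le_0_iff)
  moreover have "4 * k\<^sup>2 * x\<^sup>2 - 2 * k = 2 * k * (2 * k * x\<^sup>2 - 1)"
    by (simp add: algebra_simps power2_eq_square)
  ultimately show "(4 * k\<^sup>2 * x\<^sup>2 - 2 * k) * exp (- k * x\<^sup>2) \<le> 0"
    by (simp only: mult_nonpos_nonneg exp_ge_zero)
qed

section \<open>The mean of a randomly shifted ceiling\<close>

lemma has_integral_half_open:
  fixes h :: "real \<Rightarrow> real"
  assumes "(h has_integral I) {0..1}"
  shows "(h has_integral I) {0..<1}"
proof -
  have "negligible {1::real}" by simp
  moreover have "sym_diff {0..<1::real} {0..1} \<subseteq> {1}" by auto
  ultimately have "negligible {x \<in> {0..<1} - {0..1}. h x \<noteq> 0}" "negligible {x \<in> {0..1} - {0..<1}. h x \<noteq> 0}"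
    by (auto intro: negligible_subset)
  then show ?thesis using assms by (subst has_integral_spike_set_eq)
qed

text \<open>With \<open>k\<close> the integer part and \<open>r\<close> the fractional part of
  \<open>a\<close>, the ceiling is \<open>k + 1\<close> before \<open>r\<close> and \<open>k\<close>
  after it, so the mean is \<open>r * (k + 1) + (1 - r) * k = a\<close>. The exceptional points are
  null sets.\<close>

lemma has_integral_ceiling_shift:
  "((\<lambda>\<theta>. real_of_int \<lceil>a - \<theta>\<rceil>) has_integral a) {0..<1}"
proof (rule has_integral_half_open)
  define k where "k = \<lfloor>a\<rfloor>"
  define r where "r = a - of_int k"
  have r: "0 \<le> r" "r < 1" unfolding r_def k_def by linarith+
  have "((\<lambda>\<theta>. real_of_int \<lceil>a - \<theta>\<rceil>) has_integral (r - 0) *\<^sub>R (of_int k + 1)) {0..r}"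
  proof (rule has_integral_spike_finite[of "{r}"])
    show "((\<lambda>\<theta>. real_of_int k + 1) has_integral (r - 0) *\<^sub>R (of_int k + 1)) {0..r}"
      using has_integral_const_real[of "real_of_int k + 1" 0 r] r by simp
    fix \<theta> assume "\<theta> \<in> {0..r} - {r}"
    then have "\<lceil>a - \<theta>\<rceil> = k + 1" using r unfolding r_def by (intro ceiling_unique) auto
    then show "real_of_int \<lceil>a - \<theta>\<rceil> = of_int k + 1" by simp
  qed simp
  moreover have "((\<lambda>\<theta>. real_of_int \<lceil>a - \<theta>\<rceil>) has_integral (1 - r) *\<^sub>R (of_int k)) {r..1}"
  proof (rule has_integral_spike_finite[of "{1}"])
    show "((\<lambda>\<theta>. real_of_int k) has_integral (1 - r) *\<^sub>R (of_int k)) {r..1}"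
      using has_integral_const_real[of "real_of_int k" r 1] r by simp
    fix \<theta> assume "\<theta> \<in> {r..1} - {1}"
    then have "\<lceil>a - \<theta>\<rceil> = k" using r unfolding r_def by (intro ceiling_unique) auto
    then show "real_of_int \<lceil>a - \<theta>\<rceil> = of_int k" by simp
  qed simp
  ultimately have "((\<lambda>\<theta>. real_of_int \<lceil>a - \<theta>\<rceil>) has_integral
      ((r - 0) *\<^sub>R (of_int k + 1) + (1 - r) *\<^sub>R (of_int k))) {0..1}"
    using r by (intro has_integral_combine[where c = r]) auto
  moreover have "(r - 0) *\<^sub>R (real_of_int k + 1) + (1 - r) *\<^sub>R (real_of_int k) = a"
    by (simp add: r_def algebra_simps)
  ultimately show "((\<lambda>\<theta>. real_of_int \<lceil>a - \<theta>\<rceil>) has_integral a) {0..1}" by simp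
qed

section \<open>A run of FLH-ONS: points, matrices and weights\<close>

locale flh_run =
  fixes d :: nat and B G \<alpha> :: real and z1 :: rvec and gr :: "nat \<Rightarrow> rvec \<Rightarrow> rvec" and n :: nat
  assumes d1: "d \<ge> 1" and n1: "n \<ge> 1" and \<alpha>: "\<alpha> > 0" and G: "G \<ge> 1" and B: "B \<ge> 1"
    and z1: "z1 \<in> domD d B"
    and grad_supp: "\<And>t x. t \<in> {1..n} \<Longrightarrow> x \<in> domD d B \<Longrightarrow> vsupp d (gr t x)"
    and grad_norm: "\<And>t x. t \<in> {1..n} \<Longrightarrow> x \<in> domD d B \<Longrightarrow> norm2 d (gr t x) \<le> G"
begin

abbreviation "\<gamma> \<equiv> flh_gamma d B G \<alpha>"
abbreviation "\<zeta> \<equiv> flh_zeta d B G \<alpha>"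
abbreviation "\<eta> \<equiv> flh_eta d B G \<alpha>"
abbreviation "\<epsilon> \<equiv> flh_eps d B G \<alpha>"

text \<open>The scale of every bound below: it dominates \<open>\<gamma>\<^sup>2\<close> and, up to
  a numerical factor, \<open>1 / \<zeta>\<close>.\<close>

definition "\<Lambda> = 8 * G\<^sup>2 * B\<^sup>2 * \<alpha> * real d + 1 / \<alpha>"

text \<open>Argument \<open>t\<close> is the number of completed rounds, as in \<^const>\<open>flh_state\<close>:
  \<open>Z t j\<close> is the point of learner \<open>j\<close> in round \<open>Suc t\<close>.\<close>
definition "Z t = fst (flh_state d B G \<alpha> z1 gr t)"
definition "M t = fst (snd (flh_state d B G \<alpha> z1 gr t))"
definition "v t = snd (snd (flh_state d B G \<alpha> z1 gr t))"
definition "x = flh_pred d B G \<alpha> z1 gr"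
definition "g t = gr t (x t)"
definition "f t = surr d \<alpha> (g t) (x t)"
definition "q t y = sqrt (\<alpha> / 2) * dotp d (g t) (\<lambda>i. y i - x t i) + 1 / sqrt (2 * \<alpha>)"
definition "W t = (\<Sum>j\<in>{1..Suc t}. v t j * exp (- \<eta> * f (Suc t) (Z t j)))"

lemma f_eq: "f t y = (q t y)\<^sup>2"
  by (simp add: f_def surr_def q_def)

lemma x_Suc: "x (Suc t) = (\<lambda>i. \<Sum>j\<in>{1..Suc t}. v t j * Z t j i)"
  by (simp add: x_def flh_pred_def v_def Z_def case_prod_beta)

lemma learner_step:
  "j \<le> Suc t \<Longrightarrow> (M (Suc t) j, Z (Suc t) j) =
     ons_step d B \<zeta> (M t j) (Z t j) (surr_grad d \<alpha> (g (Suc t)) (x (Suc t)) (Z t j))"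
  unfolding g_def x_Suc
  by (simp add: M_def Z_def v_def case_prod_beta Let_def)

lemma learner_idle: "j > Suc t \<Longrightarrow> M (Suc t) j = M t j \<and> Z (Suc t) j = Z t j"
  by (simp add: M_def Z_def v_def case_prod_beta Let_def)

lemma weight_old:
  "j \<le> Suc t \<Longrightarrow> v (Suc t) j =
     (1 - 1 / real (Suc t + 1)) * (v t j * exp (- \<eta> * f (Suc t) (Z t j)) / W t)"
  unfolding g_def x_Suc W_def f_def
  by (simp add: M_def Z_def v_def case_prod_beta Let_def)

lemma weight_new: "v t (Suc t) = 1 / real (Suc t)"
  by (cases t) (simp_all add: v_def case_prod_beta Let_def)

lemma learner_init:
  "t < j \<Longrightarrow> Z t j = z1 \<and> M t j = (\<lambda>i k. if i = k then \<epsilon> else 0)"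
proof (induction t)
  case 0
  then show ?case by (simp add: Z_def M_def)
next
  case (Suc t)
  then show ?case using learner_idle[of t j] by simp
qed

lemma Z_domD: "Z t j \<in> domD d B"
proof (induction t)
  case 0
  then show ?case using z1 by (simp add: Z_def)
next
  case (Suc t)
  show ?case
  proof (cases "j \<le> Suc t")
    case True
    then have "Z (Suc t) j = snd (ons_step d B \<zeta> (M t j) (Z t j)
        (surr_grad d \<alpha> (g (Suc t)) (x (Suc t)) (Z t j)))"
      using learner_step[of j t] by (metis snd_conv)
    then show ?thesis using proj_minimizes(1)[OF z1] by (simp add: ons_step_def Let_def)
  qed (use Suc learner_idle[of t j] in simp)
qed

lemma weights: "(\<forall>j\<in>{1..Suc t}. v t j > 0) \<and> (\<Sum>j\<in>{1..Suc t}. v t j) = 1"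
proof (induction t)
  case 0
  then show ?case by (simp add: v_def)
next
  case (Suc t)
  have W: "W t > 0"
    unfolding W_def using Suc by (intro sum_pos) auto
  have "v (Suc t) j > 0" if "j \<in> {1..Suc t}" for j
  proof -
    have "0 < (1 - 1 / real (Suc t + 1))" by simp
    then show ?thesis using that Suc W by (subst weight_old) (auto intro!: mult_pos_pos divide_pos_pos)
  qed
  moreover have "v (Suc t) (Suc (Suc t)) > 0" by (subst weight_new) simp
  ultimately have pos: "\<forall>j\<in>{1..Suc (Suc t)}. v (Suc t) j > 0"
    by (metis atLeastAtMost_iff le_Suc_eq)
  have "(\<Sum>j\<in>{1..Suc t}. v (Suc t) j) =
      (\<Sum>j\<in>{1..Suc t}. (1 - 1 / real (Suc t + 1)) / W t * (v t j * exp (- \<eta> * f (Suc t) (Z t j))))"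
    by (intro sum.cong refl) (subst weight_old, auto)
  also have "\<dots> = (1 - 1 / real (Suc t + 1)) / W t * W t"
    by (subst sum_distrib_left[symmetric]) (simp only: W_def)
  also have "\<dots> = 1 - 1 / real (Suc t + 1)" using W by simp
  finally have "(\<Sum>j\<in>{1..Suc (Suc t)}. v (Suc t) j) = 1"
    using weight_new[of "Suc t"] by simp
  with pos show ?case by simp
qed

lemma W_pos: "W t > 0"
  unfolding W_def using weights[of t] by (intro sum_pos) auto

lemma x_domD: "x (Suc t) \<in> domD d B"
  unfolding x_Suc
  using weights[of t] Z_domD by (intro domD_convex_sum) (auto intro: less_imp_le)

lemma x_domD': "t \<in> {1..n} \<Longrightarrow> x t \<in> domD d B"
  using x_domD[of "t - 1"] by simp

lemma g_supp: "t \<in> {1..n} \<Longrightarrow> vsupp d (g t)"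
  using grad_supp x_domD' by (simp add: g_def)

lemma g_sq: "t \<in> {1..n} \<Longrightarrow> dotp d (g t) (g t) \<le> G\<^sup>2"
  using grad_norm[of t "x t"] x_domD'[of t] G unfolding norm2_def g_def
  by (metis dotp_self_nonneg real_sqrt_ge_0_iff real_sqrt_pow2 power_mono)

section \<open>Bounds on the parameters of the algorithm\<close>

lemma GB_pos: "G > 0" "B > 0" "real d > 0" "real d \<ge> 1"
  using G B d1 by auto

lemma \<gamma>_pos: "\<gamma> > 0"
  unfolding flh_gamma_def using GB_pos \<alpha> by (intro add_nonneg_pos) auto

lemma \<gamma>_ge: "2 * G * B * sqrt (\<alpha> * real d / 2) \<le> \<gamma>" 
  unfolding flh_gamma_def using \<alpha> by simp

lemma \<gamma>_sq_ge: "2 * G\<^sup>2 * B\<^sup>2 * \<alpha> * real d \<le> \<gamma>\<^sup>2"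
proof -
  have "(2 * G * B * sqrt (\<alpha> * real d / 2))\<^sup>2 \<le> \<gamma>\<^sup>2"
    using GB_pos \<alpha> by (intro power_mono \<gamma>_ge) simp
  then show ?thesis using \<alpha> by (simp add: power_mult_distrib mult_ac)
qed

lemma \<gamma>_sq_le: "\<gamma>\<^sup>2 \<le> \<Lambda>"
proof -
  have "(a + b)\<^sup>2 \<le> 2 * a\<^sup>2 + 2 * b\<^sup>2" for a b :: real
    using zero_le_power2[of "a - b"] by (simp add: power2_eq_square algebra_simps)
  from this[of "2 * G * B * sqrt (\<alpha> * real d / 2)" "1 / sqrt (2 * \<alpha>)"]
  have "\<gamma>\<^sup>2 \<le> 2 * (2 * G * B * sqrt (\<alpha> * real d / 2))\<^sup>2 + 2 * (1 / sqrt (2 * \<alpha>))\<^sup>2"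
    by (simp add: flh_gamma_def)
  also have "\<dots> = 4 * (G\<^sup>2 * B\<^sup>2 * \<alpha> * real d) + 1 / \<alpha>"
    using \<alpha> by (simp add: power_mult_distrib power_divide)
  also have "\<dots> \<le> \<Lambda>" unfolding \<Lambda>_def using \<alpha> by simp
  finally show ?thesis .
qed

lemma \<Lambda>_pos: "\<Lambda> > 0"
  using \<gamma>_sq_le \<gamma>_pos by (meson less_le_trans zero_less_power)

text \<open>The inequality of arithmetic and geometric means for \<open>s\<^sup>2 * \<alpha>\<close>
  and \<open>1 / \<alpha>\<close>. It lets \<Lambda> absorb the branch of \<open>1 / \<zeta>\<close>
  that does not involve \<gamma>.\<close>

lemma GB_sqrt_le: "G * B * sqrt (real d) \<le> \<Lambda>"
proof -
  define s where "s = G * B * sqrt (real d)"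
  have s2: "s\<^sup>2 = G\<^sup>2 * B\<^sup>2 * real d" by (simp add: s_def power_mult_distrib)
  have "0 \<le> (s * \<alpha> - 1)\<^sup>2 / \<alpha>" using \<alpha> by simp
  also have "\<dots> = s\<^sup>2 * \<alpha> - 2 * s + 1 / \<alpha>"
    using \<alpha> by (simp add: power2_eq_square field_simps)
  finally have "2 * s \<le> s\<^sup>2 * \<alpha> + 1 / \<alpha>" by simp
  moreover have "s \<ge> 0" using GB_pos by (simp add: s_def)
  moreover have "s\<^sup>2 * \<alpha> \<ge> 0" using \<alpha> by simp
  moreover have "\<Lambda> = 8 * (s\<^sup>2 * \<alpha>) + 1 / \<alpha>" by (simp add: \<Lambda>_def s2 mult_ac)
  ultimately show ?thesis unfolding s_def[symmetric] by linarith
qed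

lemma \<zeta>_pos: "\<zeta> > 0"
  unfolding flh_zeta_def using GB_pos \<gamma>_pos by simp

lemma \<zeta>_le: "\<zeta> \<le> 1 / (4 * \<gamma>\<^sup>2)"
  unfolding flh_zeta_def by simp

text \<open>The two branches of the minimum are at most \<open>16 * \<Lambda>\<close> and
  \<open>4 * \<Lambda>\<close>; the sum of these covers both.\<close>

lemma inverse_\<zeta>_le: "1 / \<zeta> \<le> 20 * \<Lambda>"
proof -
  have "1 / \<zeta> = 16 * G * B * sqrt (real d) \<or> 1 / \<zeta> = 4 * \<gamma>\<^sup>2"
    unfolding flh_zeta_def by (auto simp: min_def)
  then show ?thesis using GB_sqrt_le \<gamma>_sq_le \<Lambda>_pos unfolding mult.assoc by linarith
qed

lemma \<epsilon>_pos: "\<epsilon> > 0"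
  unfolding flh_eps_def using \<zeta>_pos GB_pos by simp

lemma \<epsilon>_mult: "\<epsilon> * (\<zeta>\<^sup>2 * (4 * B\<^sup>2 * real d)) = 1"
  unfolding flh_eps_def using \<zeta>_pos GB_pos by (simp add: power_mult_distrib)

lemma abs_dotp_g_le:
  assumes t: "t \<in> {1..n}" and yz: "y \<in> domD d B" "z \<in> domD d B"
  shows "\<bar>dotp d (g t) (\<lambda>i. y i - z i)\<bar> \<le> G * (2 * B * sqrt (real d))"
proof -
  have "(dotp d (g t) (\<lambda>i. y i - z i))\<^sup>2
      \<le> dotp d (g t) (g t) * dotp d (\<lambda>i. y i - z i) (\<lambda>i. y i - z i)"
    by (rule dotp_cauchy_schwarz)
  also have "\<dots> \<le> G\<^sup>2 * (4 * B\<^sup>2 * real d)"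
    using g_sq[OF t] domD_dist_le[OF yz] by (intro mult_mono) (auto simp: dotp_self_nonneg)
  also have "\<dots> = (G * (2 * B * sqrt (real d)))\<^sup>2" by (simp add: power_mult_distrib)
  finally have "\<bar>dotp d (g t) (\<lambda>i. y i - z i)\<bar> \<le> \<bar>G * (2 * B * sqrt (real d))\<bar>"
    by (simp only: abs_le_square_iff)
  then show ?thesis using GB_pos by simp
qed

text \<open>Where the formula for \<gamma> comes from: Cauchy-Schwarz with gradient norm
  \<open>G\<close> and box diameter \<open>2 * B * sqrt (real d)\<close>, plus the constant term of
  \<open>q\<close>.\<close>

lemma q_le: 
  assumes t: "t \<in> {1..n}" and y: "y \<in> domD d B"
  shows "\<bar>q t y\<bar> \<le> \<gamma>"
proof -
  have "\<bar>sqrt (\<alpha> / 2) * dotp d (g t) (\<lambda>i. y i - x t i)\<bar> \<le> sqrt (\<alpha> / 2) * (G * (2 * B * sqrt (real d)))"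
    unfolding abs_mult using abs_dotp_g_le[OF t y x_domD'[OF t]] \<alpha> by (simp add: mult_left_mono)
  also have "\<dots> = 2 * G * B * sqrt (\<alpha> * real d / 2)"
    using real_sqrt_mult[of "\<alpha> / 2" "real d"] by simp
  finally have "\<bar>sqrt (\<alpha> / 2) * dotp d (g t) (\<lambda>i. y i - x t i)\<bar> \<le> 2 * G * B * sqrt (\<alpha> * real d / 2)" .
  moreover have "0 \<le> 1 / sqrt (2 * \<alpha>)" using \<alpha> by simp
  ultimately show ?thesis unfolding q_def flh_gamma_def by linarith
qed

lemma q_sq_le: "t \<in> {1..n} \<Longrightarrow> y \<in> domD d B \<Longrightarrow> (q t y)\<^sup>2 \<le> \<gamma>\<^sup>2"
  using q_le[of t y] \<gamma>_pos by (simp add: abs_le_square_iff[symmetric])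

lemma q_diff: "q t y - q t z = sqrt (\<alpha> / 2) * dotp d (g t) (\<lambda>i. y i - z i)"
  by (simp add: q_def dotp_diff_right algebra_simps)

section \<open>Exp-concavity and the regret of the weights\<close>

lemma q_pred: "q (Suc t) (x (Suc t)) = (\<Sum>j\<in>{1..Suc t}. v t j * q (Suc t) (Z t j))"
proof -
  have w: "(\<Sum>j\<in>{1..Suc t}. v t j) = 1" using weights[of t] by simp
  define c where "c = 1 / sqrt (2 * \<alpha>) - sqrt (\<alpha> / 2) * dotp d (g (Suc t)) (x (Suc t))"
  have q: "q (Suc t) y = sqrt (\<alpha> / 2) * dotp d (g (Suc t)) y + c" for y
    by (simp add: q_def c_def dotp_diff_right algebra_simps)
  have "(\<Sum>j\<in>{1..Suc t}. v t j * q (Suc t) (Z t j))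
      = sqrt (\<alpha> / 2) * (\<Sum>j\<in>{1..Suc t}. v t j * dotp d (g (Suc t)) (Z t j)) + (\<Sum>j\<in>{1..Suc t}. v t j) * c"
    unfolding q by (simp only: ring_distribs sum.distrib sum_distrib_left sum_distrib_right mult_ac)
  also have "(\<Sum>j\<in>{1..Suc t}. v t j * dotp d (g (Suc t)) (Z t j)) = dotp d (g (Suc t)) (x (Suc t))"
    unfolding x_Suc by (rule dotp_sum_right[symmetric])
  finally show ?thesis unfolding w q by simp
qed

text \<open>Jensen's inequality: all values of \<open>q\<close> lie in the interval on which the
  exponential of the negative square is concave, and \<open>q\<close> at the prediction is their
  weighted mean.\<close>

lemma W_le:
  assumes "Suc t \<in> {1..n}"
  shows "W t \<le> exp (- \<eta> * f (Suc t) (x (Suc t)))"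
proof -
  have "(\<Sum>j\<in>{1..Suc t}. v t j * exp (- (1 / (2 * \<gamma>\<^sup>2)) * (q (Suc t) (Z t j))\<^sup>2))
      \<le> exp (- (1 / (2 * \<gamma>\<^sup>2)) * (\<Sum>j\<in>{1..Suc t}. v t j *\<^sub>R q (Suc t) (Z t j))\<^sup>2)"
  proof (rule concave_on_sum[OF _ _ concave_on_exp_neg_square[OF \<gamma>_pos]])
    show "q (Suc t) (Z t j) \<in> {- \<gamma>..\<gamma>}" for j
      using q_le[OF assms Z_domD[of t j]] by (simp add: abs_le_iff)
  qed (use weights[of t] in \<open>auto intro: less_imp_le\<close>)
  then show ?thesis
    unfolding W_def f_eq flh_eta_def q_pred by simp
qed

text \<open>The right-hand side is a potential. It is 0 at the start, when learner
  \<open>Suc r\<close> enters with weight \<open>1 / real (Suc r)\<close>. In each round the mixing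
  factor cancels the growth of the first logarithm, and \<open>W_le\<close> turns the normalization
  into the loss of the prediction.\<close>

lemma flh_vs_learner:
  assumes "r + m \<le> n"
  shows "\<eta> * (\<Sum>k<m. f (Suc (r + k)) (x (Suc (r + k))) - f (Suc (r + k)) (Z (r + k) (Suc r)))
    \<le> ln (real (Suc (r + m))) + ln (v (r + m) (Suc r))"
  using assms
proof (induction m)
  case 0
  then show ?case by (simp add: weight_new ln_div)
next
  case (Suc m)
  define t where "t = r + m"
  have t: "Suc t \<in> {1..n}" using Suc.prems by (simp add: t_def)
  have vpos: "v t (Suc r) > 0" using weights[of t] by (auto simp: t_def)
  have "ln (v (Suc t) (Suc r)) = ln ((real (Suc t) / real (Suc (Suc t))) *
      (v t (Suc r) * exp (- \<eta> * f (Suc t) (Z t (Suc r))) / W t))"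
    by (subst weight_old) (auto simp: t_def field_simps)
  also have "\<dots> = ln (real (Suc t)) - ln (real (Suc (Suc t))) + (ln (v t (Suc r)) + (- \<eta> * f (Suc t) (Z t (Suc r))) - ln (W t))"
  proof -
    have "ln (a / b * (c * exp e / w)) = ln a - ln b + (ln c + e - ln w)"
      if "0 < a" "0 < b" "0 < c" "0 < w" for a b c e w :: real
      using that by (simp add: ln_mult_pos ln_div)
    then show ?thesis using vpos W_pos[of t] by simp
  qed
  finally have v: "ln (real (Suc (Suc t))) + ln (v (Suc t) (Suc r)) =
      ln (real (Suc t)) + ln (v t (Suc r)) - \<eta> * f (Suc t) (Z t (Suc r)) - ln (W t)"
    by simp
  have "ln (W t) \<le> - \<eta> * f (Suc t) (x (Suc t))"
    using W_le[OF t] W_pos[of t] by (metis ln_exp ln_mono)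
  moreover have "\<eta> * (\<Sum>k<m. f (Suc (r + k)) (x (Suc (r + k))) - f (Suc (r + k)) (Z (r + k) (Suc r)))
     \<le> ln (real (Suc t)) + ln (v t (Suc r))"
    using Suc by (simp add: t_def)
  ultimately show ?case using v by (simp add: t_def algebra_simps)
qed

lemma ln_Suc_n: "m \<le> n \<Longrightarrow> ln (1 + real m) \<le> 1 + ln (real n)"
proof -
  assume "m \<le> n"
  have "ln (1 + real m) \<le> ln (exp 1 * real n)"
  proof (rule ln_mono)
    have "1 + real m \<le> 2 * real n" using \<open>m \<le> n\<close> n1 by linarith
    also have "\<dots> \<le> exp 1 * real n" using exp_ge_add_one_self[of 1] by (intro mult_right_mono) auto
    finally show "1 + real m \<le> exp 1 * real n" .
  qed auto
  also have "\<dots> = 1 + ln (real n)" using n1 by (simp add: ln_mult_pos)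
  finally show ?thesis .
qed

lemma flh_regret:
  assumes "r + m \<le> n"
  shows "(\<Sum>k<m. f (Suc (r + k)) (x (Suc (r + k))) - f (Suc (r + k)) (Z (r + k) (Suc r)))
    \<le> 2 * \<gamma>\<^sup>2 * (1 + ln (real n))"
proof -
  have w: "\<forall>j\<in>{1..Suc (r + m)}. v (r + m) j > 0" "(\<Sum>j\<in>{1..Suc (r + m)}. v (r + m) j) = 1"
    using weights[of "r + m"] by auto
  have "v (r + m) (Suc r) \<le> (\<Sum>j\<in>{1..Suc (r + m)}. v (r + m) j)"
    using w(1) by (intro member_le_sum) (auto intro: less_imp_le)
  moreover have "v (r + m) (Suc r) > 0" using w(1) by simp
  ultimately have "ln (v (r + m) (Suc r)) \<le> 0" using w(2) by simp
  moreover have "ln (real (Suc (r + m))) \<le> 1 + ln (real n)"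
    using ln_Suc_n[OF assms] by (simp add: add_ac)
  ultimately have "\<eta> * (\<Sum>k<m. f (Suc (r + k)) (x (Suc (r + k))) - f (Suc (r + k)) (Z (r + k) (Suc r)))
      \<le> 1 + ln (real n)"
    using flh_vs_learner[OF assms] by linarith
  then show ?thesis using \<gamma>_pos by (simp add: flh_eta_def field_simps)
qed

section \<open>Regret of a single learner, and of the combination on an interval\<close>

lemma surr_grad_eq: "surr_grad d \<alpha> (g t) (x t) y = (\<lambda>i. (2 * q t y * sqrt (\<alpha> / 2)) * g t i)"
  by (simp add: surr_grad_def q_def)

text \<open>The identity \<open>a\<^sup>2 - b\<^sup>2 = 2a(a - b) - (a - b)\<^sup>2\<close> with \<open>a\<^sup>2 \<le> \<gamma>\<^sup>2\<close> and \<open>2\<zeta>\<gamma>\<^sup>2 \<le> 1\<close>.\<close>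
lemma f_diff_le:
  fixes u :: rvec
  assumes t: "t \<in> {1..n}" and y: "y \<in> domD d B"
  defines "D \<equiv> dotp d (surr_grad d \<alpha> (g t) (x t) y) (\<lambda>i. y i - u i)"
  shows "f t y - f t u \<le> D - \<zeta> / 2 * D\<^sup>2"
proof -
  define a b where "a = q t y" and "b = q t u"
  have D: "D = 2 * a * (a - b)"
    unfolding D_def surr_grad_eq dotp_scale_left a_def b_def q_diff by simp
  have "2 * \<zeta> * a\<^sup>2 \<le> 2 * (1 / (4 * \<gamma>\<^sup>2)) * \<gamma>\<^sup>2"
    unfolding a_def using \<zeta>_le \<zeta>_pos q_sq_le[OF t y] by (intro mult_mono) auto
  also have "\<dots> \<le> 1" using \<gamma>_pos by simp
  finally have "2 * \<zeta> * a\<^sup>2 * (a - b)\<^sup>2 \<le> 1 * (a - b)\<^sup>2" by (intro mult_right_mono) auto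
  moreover have "\<zeta> / 2 * D\<^sup>2 = 2 * \<zeta> * a\<^sup>2 * (a - b)\<^sup>2" unfolding D by (simp add: power_mult_distrib)
  moreover have "a\<^sup>2 - b\<^sup>2 = D - (a - b)\<^sup>2" unfolding D by (simp add: power2_eq_square algebra_simps)
  ultimately show ?thesis unfolding f_eq a_def[symmetric] b_def[symmetric] by linarith
qed

text \<open>This is what the choice of \<epsilon> achieves: after \<open>k\<close> updates a
  diagonal entry is at most \<open>\<epsilon> * (1 + real k)\<close>, so the logarithms in the
  elliptical potential involve the number of rounds only.\<close>

lemma surr_grad_sq_le:
  assumes t: "t \<in> {1..n}" and y: "y \<in> domD d B" and i: "i < d"
  shows "(surr_grad d \<alpha> (g t) (x t) y i)\<^sup>2 \<le> \<epsilon>"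
proof -
  have "g t i * g t i \<le> dotp d (g t) (g t)"
    unfolding dotp_def using i by (intro member_le_sum[where f = "\<lambda>i. g t i * g t i"]) auto
  then have gi: "(g t i)\<^sup>2 \<le> G\<^sup>2" using g_sq[OF t] by (simp add: power2_eq_square)
  have "(surr_grad d \<alpha> (g t) (x t) y i)\<^sup>2 = 2 * \<alpha> * ((q t y)\<^sup>2 * (g t i)\<^sup>2)"
    unfolding surr_grad_eq using \<alpha> by (simp add: power_mult_distrib)
  also have "\<dots> \<le> 2 * \<alpha> * (\<gamma>\<^sup>2 * G\<^sup>2)"
    using \<alpha> gi q_sq_le[OF t y] by (intro mult_left_mono mult_mono) auto
  \<comment> \<open>A factor 1 in the form of \<open>\<epsilon>_mult\<close> brings in \<epsilon>;
    the remaining factors are then controlled by \<open>\<gamma>_sq_ge\<close> and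
    \<open>\<zeta>_le\<close>.\<close>
  also have "\<dots> = 2 * \<alpha> * (\<gamma>\<^sup>2 * G\<^sup>2) * (\<epsilon> * (\<zeta>\<^sup>2 * (4 * B\<^sup>2 * real d)))"
    using \<epsilon>_mult by simp
  also have "\<dots> = \<epsilon> * (4 * (2 * G\<^sup>2 * B\<^sup>2 * \<alpha> * real d) * \<gamma>\<^sup>2 * \<zeta>\<^sup>2)"
    by (simp add: mult_ac)
  also have "\<dots> \<le> \<epsilon> * (4 * \<gamma>\<^sup>2 * \<gamma>\<^sup>2 * (1 / (4 * \<gamma>\<^sup>2))\<^sup>2)"
    using \<epsilon>_pos \<zeta>_pos \<zeta>_le \<gamma>_sq_ge less_imp_le[OF \<gamma>_pos]
    by (intro mult_left_mono mult_mono power_mono) auto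
  also have "\<dots> \<le> \<epsilon> * 1"
    using \<epsilon>_pos \<gamma>_pos by (intro mult_left_mono) (auto simp: power2_eq_square)
  finally show ?thesis by simp
qed

text \<open>\<open>f_diff_le\<close> reduces the claim to \<open>ons_regret\<close>. The potential
  contributes \<open>real d * (1 + ln (real n)) / (2 * \<zeta>)\<close>, and by the choice of
  \<epsilon> the initial distance contributes at most \<open>1 / (2 * \<zeta>)\<close>, which the
  former absorbs.\<close>

lemma learner_regret:
  assumes rm: "r + m \<le> n" and u: "u \<in> domD d B"
  shows "(\<Sum>k<m. f (Suc (r + k)) (Z (r + k) (Suc r)) - f (Suc (r + k)) u)
    \<le> 20 * real d * \<Lambda> * (1 + ln (real n))"
proof -
  define gz where "gz = (\<lambda>k. surr_grad d \<alpha> (g (Suc (r + k))) (x (Suc (r + k))) (Z (r + k) (Suc r)))"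
  define Y where "Y = (\<lambda>k. Z (r + k) (Suc r))"
  define A where "A = (\<lambda>k. M (r + k) (Suc r))"
  have idx: "Suc (r + k) \<in> {1..n}" if "k < m" for k using that rm by auto
  have A0: "A 0 = (\<lambda>i j. if i = j then \<epsilon> else 0)" using learner_init[of r "Suc r"] by (simp add: A_def)
  have step: "(A (Suc k), Y (Suc k)) = ons_step d B \<zeta> (A k) (Y k) (gz k)" for k
    unfolding A_def Y_def gz_def using learner_step[of "Suc r" "r + k"] by simp
  have supp: "vsupp d (gz k)" if "k < m" for k
    using g_supp[OF idx[OF that]] by (simp add: gz_def surr_grad_eq vsupp_def)
  have reg: "(\<Sum>k<m. dotp d (gz k) (\<lambda>i. Y k i - u i) - \<zeta> / 2 * (dotp d (gz k) (\<lambda>i. Y k i - u i))\<^sup>2)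
    \<le> 1 / (2 * \<zeta>) * (\<Sum>i<d. ln (A m i i / \<epsilon>)) + \<zeta> / 2 * (\<epsilon> * dotp d (\<lambda>i. Y 0 i - u i) (\<lambda>i. Y 0 i - u i))"
    by (rule ons_regret[OF \<epsilon>_pos \<zeta>_pos u A0 step supp])
  have diag: "\<epsilon> \<le> A k i i \<and> A k i i \<le> \<epsilon> * (1 + real k)" if "k \<le> m" "i < d" for k i
    using that(1)
  proof (induction k)
    case 0
    then show ?case by (simp add: A0)
  next
    case (Suc k)
    have "A (Suc k) i i = A k i i + (gz k i)\<^sup>2"
      using step[of k] by (simp add: ons_step_def Let_def power2_eq_square)
    moreover have "(gz k i)\<^sup>2 \<le> \<epsilon>"
      unfolding gz_def using Suc.prems by (intro surr_grad_sq_le idx Z_domD that) auto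
    moreover have "0 \<le> (gz k i)\<^sup>2" by simp
    moreover have "\<epsilon> \<le> A k i i" "A k i i \<le> \<epsilon> * (1 + real k)" using Suc by auto
    moreover have "\<epsilon> * (1 + real (Suc k)) = \<epsilon> * (1 + real k) + \<epsilon>" by (simp add: algebra_simps)
    ultimately show ?case by linarith
  qed
  have ln1: "ln (A m i i / \<epsilon>) \<le> 1 + ln (real n)" if "i < d" for i
  proof -
    have "0 < A m i i / \<epsilon>" "A m i i / \<epsilon> \<le> 1 + real m"
      using diag[OF order_refl that] \<epsilon>_pos by (auto simp: field_simps intro!: divide_pos_pos)
    then have "ln (A m i i / \<epsilon>) \<le> ln (1 + real m)" by (simp add: ln_mono)
    also have "\<dots> \<le> 1 + ln (real n)" using rm by (intro ln_Suc_n) auto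
    finally show ?thesis .
  qed
  have "(\<Sum>i<d. ln (A m i i / \<epsilon>)) \<le> (\<Sum>i<d. 1 + ln (real n))"
    using ln1 by (intro sum_mono) auto
  then have "1 / (2 * \<zeta>) * (\<Sum>i<d. ln (A m i i / \<epsilon>)) \<le> 1 / (2 * \<zeta>) * (real d * (1 + ln (real n)))"
    using \<zeta>_pos by (intro mult_left_mono) auto
  moreover have "\<zeta> / 2 * (\<epsilon> * dotp d (\<lambda>i. Y 0 i - u i) (\<lambda>i. Y 0 i - u i)) \<le> 1 / (2 * \<zeta>)"
  proof -
    have "\<zeta> / 2 * (\<epsilon> * dotp d (\<lambda>i. Y 0 i - u i) (\<lambda>i. Y 0 i - u i)) \<le> \<zeta> / 2 * (\<epsilon> * (4 * B\<^sup>2 * real d))"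
      using \<zeta>_pos \<epsilon>_pos domD_dist_le[OF Z_domD u] by (intro mult_left_mono) (auto simp: Y_def)
    also have "\<dots> = 1 / (2 * \<zeta>) * (\<epsilon> * (\<zeta>\<^sup>2 * (4 * B\<^sup>2 * real d)))"
      using \<zeta>_pos by (simp add: power2_eq_square)
    finally show ?thesis using \<epsilon>_mult by simp
  qed
  moreover have "(\<Sum>k<m. f (Suc (r + k)) (Z (r + k) (Suc r)) - f (Suc (r + k)) u) \<le>
      (\<Sum>k<m. dotp d (gz k) (\<lambda>i. Y k i - u i) - \<zeta> / 2 * (dotp d (gz k) (\<lambda>i. Y k i - u i))\<^sup>2)"
    unfolding gz_def Y_def using idx by (intro sum_mono f_diff_le Z_domD) auto
  ultimately have "(\<Sum>k<m. f (Suc (r + k)) (Z (r + k) (Suc r)) - f (Suc (r + k)) u)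
      \<le> 1 / (2 * \<zeta>) * (real d * (1 + ln (real n))) + 1 / (2 * \<zeta>)"
    using reg by linarith
  also have "\<dots> = 1 / \<zeta> * ((real d * (1 + ln (real n)) + 1) / 2)"
    by (simp add: add_divide_distrib ring_distribs)
  also have "\<dots> \<le> (20 * \<Lambda>) * (real d * (1 + ln (real n)))"
  proof (intro mult_mono inverse_\<zeta>_le)
    have "1 * 1 \<le> real d * (1 + ln (real n))" using GB_pos n1 by (intro mult_mono) auto
    then show "(real d * (1 + ln (real n)) + 1) / 2 \<le> real d * (1 + ln (real n))"
      "0 \<le> (real d * (1 + ln (real n)) + 1) / 2" by auto
  qed (use \<Lambda>_pos in auto)
  finally show ?thesis by (simp only: mult_ac)
qed

text \<open>The cost of one interval: 2 for competing with a learner and 20 for that learner's own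
  regret.\<close>

definition "R = 22 * real d * \<Lambda> * (1 + ln (real n))"

text \<open>The intermediary is the learner started in the first round of the interval: the weights
  compete with it, and it competes with \<open>u\<close>.\<close>

lemma adaptive_regret:
  assumes rs: "1 \<le> r" "r \<le> s" "s \<le> n" and u: "u \<in> domD d B"
  shows "(\<Sum>t\<in>{r..s}. f t (x t) - f t u) \<le> R"
proof -
  define r' m where "r' = r - 1" and "m = Suc s - r"
  have rm: "r' + m \<le> n" using rs by (auto simp: r'_def m_def)
  have "(\<Sum>t\<in>{r..s}. f t (x t) - f t u) = (\<Sum>k<m. f (Suc (r' + k)) (x (Suc (r' + k))) - f (Suc (r' + k)) u)"
    by (rule sum.reindex_bij_witness[of _ "\<lambda>k. Suc (r' + k)" "\<lambda>t. t - r"])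
      (use rs in \<open>auto simp: r'_def m_def\<close>)
  also have "\<dots> = (\<Sum>k<m. f (Suc (r' + k)) (x (Suc (r' + k))) - f (Suc (r' + k)) (Z (r' + k) (Suc r')))
     + (\<Sum>k<m. f (Suc (r' + k)) (Z (r' + k) (Suc r')) - f (Suc (r' + k)) u)"
    by (simp flip: sum.distrib)
  also have "\<dots> \<le> 2 * \<gamma>\<^sup>2 * (1 + ln (real n)) + 20 * real d * \<Lambda> * (1 + ln (real n))"
    by (intro add_mono flh_regret learner_regret rm u)
  also have "2 * \<gamma>\<^sup>2 * (1 + ln (real n)) \<le> 2 * real d * \<Lambda> * (1 + ln (real n))"
  proof (intro mult_right_mono)
    have "1 * \<gamma>\<^sup>2 \<le> real d * \<Lambda>" using \<gamma>_sq_le GB_pos \<gamma>_pos by (intro mult_mono) auto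
    then show "2 * \<gamma>\<^sup>2 \<le> 2 * real d * \<Lambda>" by simp
  qed (use n1 in simp)
  finally show ?thesis by (simp add: R_def mult_ac)
qed

lemma R_nonneg: "R \<ge> 0"
  unfolding R_def using \<Lambda>_pos n1 by simp

section \<open>Randomized rounding of the comparators\<close>

text \<open>Each block on which \<open>w\<close> is constant costs at most \<open>R\<close>, and
  there is one block more than there are switches.\<close>

lemma piecewise_regret:
  assumes w: "\<And>t. t \<in> {1..n} \<Longrightarrow> w t \<in> domD d B"
  shows "(\<Sum>t\<in>{1..n}. f t (x t) - f t (w t)) \<le> R + R * (\<Sum>t\<in>{2..n}. if w t \<noteq> w (t - 1) then 1 else 0)"
proof -
  define reg where "reg = (\<lambda>t. f t (x t) - f t (w t))"
  define sw where "sw = (\<lambda>t. if w t \<noteq> w (t - 1) then 1 else 0 :: real)"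
  \<comment> \<open>The block ending at \<open>m\<close> stays open: only the regret before its
    first round \<open>r\<close> has been charged to switches. A switch closes the block, and the
    last block is closed after the induction.\<close>
  have "\<exists>r\<in>{1..m}. (\<forall>t\<in>{r..m}. w t = w m) \<and> sum reg {1..<r} \<le> R * sum sw {2..m}"
    if "1 \<le> m" "m \<le> n" for m
    using that
  proof (induction m rule: nat_induct_at_least)
    case base
    show ?case by (intro bexI[of _ 1]) auto
  next
    case (Suc m)
    have "\<exists>r\<in>{1..m}. (\<forall>t\<in>{r..m}. w t = w m) \<and> sum reg {1..<r} \<le> R * sum sw {2..m}"
      using Suc.prems by (intro Suc.IH) simp
    then obtain r where r: "r \<in> {1..m}" "\<forall>t\<in>{r..m}. w t = w m" "sum reg {1..<r} \<le> R * sum sw {2..m}"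
      by blast
    have sum_sw: "sum sw {2..Suc m} = sum sw {2..m} + sw (Suc m)" using Suc.hyps by simp
    show ?case
    proof (cases "w (Suc m) = w m")
      case True
      then have "\<forall>t\<in>{r..Suc m}. w t = w (Suc m)"
        by (metis atLeastAtMost_iff le_Suc_eq r(2))
      moreover have "sw (Suc m) = 0" using True by (simp add: sw_def)
      then have "sum reg {1..<r} \<le> R * sum sw {2..Suc m}"
        using r(3) unfolding sum_sw by simp
      moreover have "r \<in> {1..Suc m}" using r(1) by simp
      ultimately show ?thesis by blast
    next
      case False
      have "sum reg {1..<Suc m} = sum reg {1..<r} + sum reg {r..<Suc m}"
        using r(1) by (subst sum.atLeastLessThan_concat) auto
      also have "sum reg {r..<Suc m} = (\<Sum>t\<in>{r..m}. f t (x t) - f t (w m))"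
      proof (rule sum.cong)
        fix t assume "t \<in> {r..m}"
        then have "w t = w m" by (rule r(2)[rule_format])
        then show "reg t = f t (x t) - f t (w m)" by (simp only: reg_def)
      qed (rule atLeastLessThanSuc_atLeastAtMost)
      also have "\<dots> \<le> R"
        using r(1) Suc.prems by (intro adaptive_regret[of r m] w) simp_all
      finally have "sum reg {1..<Suc m} \<le> R * sum sw {2..m} + R" using r(3) by linarith
      also have "\<dots> = R * sum sw {2..Suc m}"
      proof -
        have "sw (Suc m) = 1" using False by (simp add: sw_def)
        then show ?thesis unfolding sum_sw by (simp add: ring_distribs)
      qed
      finally show ?thesis by (intro bexI[of _ "Suc m"]) simp_all
    qed
  qed
  from this[OF n1 order_refl] obtain r where
    r: "r \<in> {1..n}" "\<forall>t\<in>{r..n}. w t = w n" "sum reg {1..<r} \<le> R * sum sw {2..n}" by blast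
  have "sum reg {1..n} = sum reg {1..<r} + sum reg {r..<Suc n}"
    using r(1) by (subst sum.atLeastLessThan_concat) (auto simp: atLeastLessThanSuc_atLeastAtMost)
  also have "sum reg {r..<Suc n} = (\<Sum>t\<in>{r..n}. f t (x t) - f t (w n))"
  proof (rule sum.cong)
    fix t assume "t \<in> {r..n}"
    then have "w t = w n" by (rule r(2)[rule_format])
    then show "reg t = f t (x t) - f t (w n)" by (simp only: reg_def)
  qed (rule atLeastLessThanSuc_atLeastAtMost)
  also have "\<dots> \<le> R"
    using r(1) by (intro adaptive_regret[of r n] w) simp_all
  finally have "sum reg {1..n} \<le> R + R * sum sw {2..n}" using r(3) by linarith
  then show ?thesis unfolding reg_def sw_def .
qed

text \<open>All rounds and coordinates share one random shift \<open>\<theta>\<close>, uniform on \<open>[0,1)\<close>. The only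
  expectation needed is that of \<open>\<lceil>a - \<theta>\<rceil>\<close>, which is \<open>a\<close>: by monotonicity of the ceiling it also gives
  the expected number of switches. At \<open>\<theta> = 1\<close> the rounded point could leave the box.\<close>
lemma rounded_comparator_regret:
  assumes w: "w \<in> comparators d B n C" and N: "N \<ge> (1::nat)"
  defines "s \<equiv> 2 * B / real N"
  shows "(\<Sum>t\<in>{1..n}. f t (x t) - f t (w t)) \<le> R + R * (C / s) + real n * (\<alpha> / 2 * (G\<^sup>2 * (real d * s\<^sup>2)))"
proof -
  have s: "s > 0" using GB_pos N by (simp add: s_def)
  have wD: "\<And>t. t \<in> {1..n} \<Longrightarrow> w t \<in> domD d B"
    and path: "(\<Sum>t\<in>{2..n}. norm1 d (\<lambda>i. w t i - w (t - 1) i)) \<le> C"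
    using w by (auto simp: comparators_def)
  define a where "a = (\<lambda>t i. (w t i + B) / s)"
  define c where "c = (\<lambda>t i \<theta>. real_of_int \<lceil>a t i - \<theta>\<rceil>)"
  define \<rho> where "\<rho> = (\<lambda>\<theta> t i. if i < d then - B + s * c t i \<theta> else 0)"
  define E where "E = \<alpha> / 2 * (G\<^sup>2 * (real d * s\<^sup>2))"
  \<comment> \<open>Multiplying by the sign \<open>e\<close> replaces the absolute change of
    \<open>c\<close> by an expression linear in \<open>c\<close>, which can be integrated termwise.
    \<open>b\<close> holds the coefficients of the linear part of the surrogate at
    \<open>w t\<close>.\<close>
  define e where "e = (\<lambda>t i. sgn (a t i - a (t - 1) i))"
  define b where "b = (\<lambda>t i. 2 * q t (w t) * sqrt (\<alpha> / 2) * g t i * s)"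
  have diff: "\<rho> \<theta> t i - w t i = s * (c t i \<theta> - a t i)" if "i < d" for \<theta> t i
    using that s by (simp add: \<rho>_def a_def field_simps)
  \<comment> \<open>The width \<open>s\<close> divides the side \<open>2 * B\<close> into exactly
    \<open>N\<close> cells, so the topmost grid point is \<open>B\<close> itself.\<close>
  have \<rho>D: "\<rho> \<theta> t \<in> domD d B" if "t \<in> {1..n}" "\<theta> \<in> {0..<1}" for t \<theta>
  proof -
    have "\<bar>- B + s * c t i \<theta>\<bar> \<le> B" if i: "i < d" for i
    proof -
      have "\<bar>w t i\<bar> \<le> B" using wD[OF \<open>t \<in> {1..n}\<close>] i by (auto simp: domD_def)
      then have wi: "0 \<le> w t i + B" "w t i + B \<le> 2 * B" by auto
      have "0 \<le> a t i" using wi s by (simp add: a_def)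
      moreover have "a t i \<le> real N" 
      proof -
        have "a t i \<le> 2 * B / s" unfolding a_def using wi s by (intro divide_right_mono) auto
        also have "\<dots> = real N" using GB_pos N by (simp add: s_def)
        finally show ?thesis .
      qed
      ultimately have "-1 < a t i - \<theta>" "a t i - \<theta> \<le> of_int (int N)" using \<open>\<theta> \<in> {0..<1}\<close> by auto
      then have "0 \<le> \<lceil>a t i - \<theta>\<rceil>" "\<lceil>a t i - \<theta>\<rceil> \<le> int N"
        by (simp_all only: ceiling_le_iff zero_le_ceiling)
      then have "0 \<le> c t i \<theta>" "c t i \<theta> \<le> real N" unfolding c_def by linarith+
      then have "0 \<le> s * c t i \<theta>" "s * c t i \<theta> \<le> s * real N" using s by (auto intro: mult_left_mono)
      moreover have "s * real N = 2 * B" using N by (simp add: s_def)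
      ultimately show ?thesis by linarith
    qed
    then show ?thesis by (auto simp: domD_def vsupp_def \<rho>_def)
  qed
  \<comment> \<open>Distinct rounded points differ in some integer coordinate, hence there by at
    least 1.\<close>
  have jump: "(if \<rho> \<theta> t \<noteq> \<rho> \<theta> (t - 1) then 1 else 0) \<le> (\<Sum>i<d. e t i * (c t i \<theta> - c (t - 1) i \<theta>))" for \<theta> t
  proof -
    have abs: "e t i * (c t i \<theta> - c (t - 1) i \<theta>) = \<bar>c t i \<theta> - c (t - 1) i \<theta>\<bar>" for i
    proof -
      consider "a t i = a (t - 1) i" | "a t i < a (t - 1) i" | "a t i > a (t - 1) i" by linarith
      then show ?thesis
      proof cases
        case 2
        then have "c t i \<theta> \<le> c (t - 1) i \<theta>" by (simp add: c_def ceiling_mono)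
        then show ?thesis using 2 by (simp add: e_def)
      next
        case 3
        then have "c (t - 1) i \<theta> \<le> c t i \<theta>" by (simp add: c_def ceiling_mono)
        then show ?thesis using 3 by (simp add: e_def)
      qed (simp add: e_def c_def)
    qed
    show ?thesis
    proof (cases "\<rho> \<theta> t = \<rho> \<theta> (t - 1)")
      case False
      then obtain i where i: "i < d" "c t i \<theta> \<noteq> c (t - 1) i \<theta>"
        by (auto simp: \<rho>_def fun_eq_iff split: if_splits)
      then have "1 \<le> \<bar>\<lceil>a t i - \<theta>\<rceil> - \<lceil>a (t - 1) i - \<theta>\<rceil>\<bar>" unfolding c_def by linarith
      then have "1 \<le> \<bar>c t i \<theta> - c (t - 1) i \<theta>\<bar>"
        unfolding c_def by (metis of_int_1_le_iff of_int_abs of_int_diff)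
      also have "\<dots> \<le> (\<Sum>i<d. \<bar>c t i \<theta> - c (t - 1) i \<theta>\<bar>)"
        using i by (intro member_le_sum[where f = "\<lambda>i. \<bar>c t i \<theta> - c (t - 1) i \<theta>\<bar>"]) auto
      finally show ?thesis using False unfolding abs by simp
    next
      case True
      then show ?thesis unfolding abs by (simp add: sum_nonneg)
    qed
  qed
  \<comment> \<open>The square is expanded around \<open>w t\<close>. The linear part is kept
    exactly, to be averaged over \<theta>; the quadratic part is bounded for each \<theta>, as every
    coordinate moves by at most \<open>s\<close>.\<close>
  have round: "f t (\<rho> \<theta> t) - f t (w t) \<le> (\<Sum>i<d. b t i * (c t i \<theta> - a t i)) + E"
    if t: "t \<in> {1..n}" and \<theta>: "\<theta> \<in> {0..<1}" for t \<theta>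
  proof -
    define D where "D = dotp d (g t) (\<lambda>i. \<rho> \<theta> t i - w t i)"
    have "f t (\<rho> \<theta> t) - f t (w t) = 2 * q t (w t) * (q t (\<rho> \<theta> t) - q t (w t)) + (q t (\<rho> \<theta> t) - q t (w t))\<^sup>2"
      unfolding f_eq by (simp add: power2_eq_square algebra_simps)
    also have "\<dots> = 2 * q t (w t) * sqrt (\<alpha> / 2) * D + \<alpha> / 2 * D\<^sup>2"
      unfolding q_diff D_def[symmetric] using \<alpha> by (simp add: power_mult_distrib)
    also have "2 * q t (w t) * sqrt (\<alpha> / 2) * D = (\<Sum>i<d. b t i * (c t i \<theta> - a t i))"
      unfolding D_def dotp_def b_def sum_distrib_left using diff by (intro sum.cong) auto
    also have "\<alpha> / 2 * D\<^sup>2 \<le> E"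
    proof -
      have "D\<^sup>2 \<le> dotp d (g t) (g t) * dotp d (\<lambda>i. \<rho> \<theta> t i - w t i) (\<lambda>i. \<rho> \<theta> t i - w t i)"
        unfolding D_def by (rule dotp_cauchy_schwarz)
      also have "\<dots> \<le> G\<^sup>2 * (real d * s\<^sup>2)"
      proof (intro mult_mono g_sq t)
        have "dotp d (\<lambda>i. \<rho> \<theta> t i - w t i) (\<lambda>i. \<rho> \<theta> t i - w t i) \<le> (\<Sum>i<d. s\<^sup>2)"
          unfolding dotp_def
        proof (rule sum_mono)
          fix i assume "i \<in> {..<d}"
          then have "(\<rho> \<theta> t i - w t i) * (\<rho> \<theta> t i - w t i) = s\<^sup>2 * (c t i \<theta> - a t i)\<^sup>2"
            by (simp add: diff power2_eq_square)
          moreover have "\<bar>c t i \<theta> - a t i\<bar> \<le> 1"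
            using \<theta> ceiling_correct[of "a t i - \<theta>"] unfolding c_def atLeastLessThan_iff by linarith
          then have "(c t i \<theta> - a t i)\<^sup>2 \<le> 1" by (simp add: abs_square_le_1)
          then have "s\<^sup>2 * (c t i \<theta> - a t i)\<^sup>2 \<le> s\<^sup>2 * 1" by (intro mult_left_mono) auto
          ultimately show "(\<rho> \<theta> t i - w t i) * (\<rho> \<theta> t i - w t i) \<le> s\<^sup>2" by simp
        qed
        then show "dotp d (\<lambda>i. \<rho> \<theta> t i - w t i) (\<lambda>i. \<rho> \<theta> t i - w t i) \<le> real d * s\<^sup>2" by simp
      qed (auto simp: dotp_self_nonneg)
      finally show ?thesis unfolding E_def using \<alpha> by (intro mult_left_mono) auto
    qed
    finally show ?thesis by simp
  qed
  \<comment> \<open>\<open>\<Phi>\<close> is affine in the values of \<open>c\<close>, so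
    integration replaces \<open>c\<close> by \<open>a\<close> and kills the linear part of the
    surrogates. The left-hand side of \<open>le\<close> does not depend on \<theta> and equals its
    own mean.\<close>
  define \<Phi> where "\<Phi> = (\<lambda>\<theta>. (R + R * (\<Sum>t\<in>{2..n}. \<Sum>i<d. e t i * (c t i \<theta> - c (t - 1) i \<theta>)))
      + (\<Sum>t\<in>{1..n}. (\<Sum>i<d. b t i * (c t i \<theta> - a t i)) + E))"
  have le: "(\<Sum>t\<in>{1..n}. f t (x t) - f t (w t)) \<le> \<Phi> \<theta>" if "\<theta> \<in> {0..<1}" for \<theta>
  proof -
    have "(\<Sum>t\<in>{1..n}. f t (x t) - f t (w t)) =
      (\<Sum>t\<in>{1..n}. f t (x t) - f t (\<rho> \<theta> t)) + (\<Sum>t\<in>{1..n}. f t (\<rho> \<theta> t) - f t (w t))"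
      by (simp flip: sum.distrib)
    also have "\<dots> \<le> (R + R * (\<Sum>t\<in>{2..n}. if \<rho> \<theta> t \<noteq> \<rho> \<theta> (t - 1) then 1 else 0))
       + (\<Sum>t\<in>{1..n}. (\<Sum>i<d. b t i * (c t i \<theta> - a t i)) + E)"
      using \<rho>D that by (intro add_mono piecewise_regret sum_mono round) auto
    also have "\<dots> \<le> \<Phi> \<theta>"
      unfolding \<Phi>_def using jump R_nonneg
      by (intro add_mono order_refl mult_left_mono sum_mono) auto
    finally show ?thesis .
  qed
  have one: "((\<lambda>\<theta>. k) has_integral k) {0..<1::real}" for k :: real
    using has_integral_half_open[OF has_integral_const_real[of k 0 1, simplified]] by simp
  have cint: "((\<lambda>\<theta>. c t i \<theta>) has_integral a t i) {0..<1}" for t i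
    unfolding c_def by (rule has_integral_ceiling_shift)
  have "(\<Phi> has_integral (R + R * (\<Sum>t\<in>{2..n}. \<Sum>i<d. e t i * (a t i - a (t - 1) i)))
      + (\<Sum>t\<in>{1..n}. (\<Sum>i<d. b t i * (a t i - a t i)) + E)) {0..<1}"
    unfolding \<Phi>_def
    by (intro has_integral_add has_integral_mult_right has_integral_sum has_integral_diff one cint finite_atLeastAtMost finite_lessThan)
  then have "(\<Sum>t\<in>{1..n}. f t (x t) - f t (w t)) \<le> (R + R * (\<Sum>t\<in>{2..n}. \<Sum>i<d. e t i * (a t i - a (t - 1) i)))
      + (\<Sum>t\<in>{1..n}. (\<Sum>i<d. b t i * (a t i - a t i)) + E)"
    using has_integral_le[OF one] le by blast
  also have "(\<Sum>t\<in>{1..n}. (\<Sum>i<d. b t i * (a t i - a t i)) + E) = real n * E" by simp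
  also have "(\<Sum>t\<in>{2..n}. \<Sum>i<d. e t i * (a t i - a (t - 1) i)) \<le> C / s"
  proof -
    have "e t i * (a t i - a (t - 1) i) = \<bar>w t i - w (t - 1) i\<bar> / s" for t i
    proof -
      have "a t i - a (t - 1) i = (w t i - w (t - 1) i) / s"
        by (simp add: a_def diff_divide_distrib add_divide_distrib)
      moreover have "e t i * (a t i - a (t - 1) i) = \<bar>a t i - a (t - 1) i\<bar>"
        by (simp add: e_def abs_sgn mult.commute)
      ultimately show ?thesis using s by (simp only: abs_divide abs_of_pos)
    qed
    then have "(\<Sum>t\<in>{2..n}. \<Sum>i<d. e t i * (a t i - a (t - 1) i)) =
        (\<Sum>t\<in>{2..n}. norm1 d (\<lambda>i. w t i - w (t - 1) i)) / s"
      by (simp add: norm1_def sum_divide_distrib)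
    also have "\<dots> \<le> C / s" using path s by (intro divide_right_mono) auto
    finally show ?thesis .
  qed
  finally show ?thesis using R_nonneg by (simp add: E_def mult_left_mono)
qed

text \<open>Rounding up the number of cells turns an arbitrary width \<sigma> into an admissible
  width \<open>s\<close> between \<open>\<sigma> / 2\<close> and \<sigma>. The lower bound costs the
  factor 2 in front of \<open>C / \<sigma>\<close>.\<close>

lemma tracking_regret:
  assumes w: "w \<in> comparators d B n C" and \<sigma>: "0 < \<sigma>" "\<sigma> \<le> 1" and C: "C \<ge> 0"
  shows "(\<Sum>t\<in>{1..n}. f t (x t) - f t (w t)) \<le> R * (1 + 2 * (C / \<sigma>)) + \<Lambda> * (real n * \<sigma>\<^sup>2)"
proof -
  define N where "N = nat \<lceil>2 * B / \<sigma>\<rceil>"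
  have two: "2 \<le> 2 * B / \<sigma>" using B \<sigma> by (simp add: field_simps)
  then have N: "2 * B / \<sigma> \<le> real N" "real N \<le> 2 * B / \<sigma> + 1" unfolding N_def by linarith+
  then have N1: "N \<ge> 1" "real N > 0" using two by linarith+
  define s where "s = 2 * B / real N"
  have s: "0 < s" "s \<le> \<sigma>" using N N1 GB_pos \<sigma> by (auto simp: s_def field_simps)
  have "1 / s \<le> 2 / \<sigma>"
  proof -
    have "1 / s = real N / (2 * B)" by (simp add: s_def)
    also have "\<dots> \<le> (2 * (2 * B / \<sigma>)) / (2 * B)"
      using N two GB_pos by (intro divide_right_mono) linarith+
    also have "\<dots> = 2 / \<sigma>" using GB_pos by simp
    finally show ?thesis .
  qed
  then have "C * (1 / s) \<le> C * (2 / \<sigma>)" using C by (rule mult_left_mono)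
  then have "R * (C / s) \<le> R * (2 * (C / \<sigma>))"
    using R_nonneg by (intro mult_left_mono) (auto simp: mult_ac)
  moreover have "real n * (\<alpha> / 2 * (G\<^sup>2 * (real d * s\<^sup>2))) \<le> \<Lambda> * (real n * \<sigma>\<^sup>2)"
  proof -
    have "1 \<le> B\<^sup>2" using B by simp
    then have "\<alpha> * G\<^sup>2 * real d * 1 \<le> \<alpha> * G\<^sup>2 * real d * (16 * B\<^sup>2)"
      using \<alpha> by (intro mult_left_mono) auto
    then have "\<alpha> / 2 * G\<^sup>2 * real d \<le> \<Lambda>"
      unfolding \<Lambda>_def using \<alpha> by (simp add: mult_ac add_increasing2)
    moreover have "s\<^sup>2 \<le> \<sigma>\<^sup>2" using s by (intro power_mono) auto
    ultimately have "(\<alpha> / 2 * G\<^sup>2 * real d) * (real n * s\<^sup>2) \<le> \<Lambda> * (real n * \<sigma>\<^sup>2)"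
      using \<Lambda>_pos by (intro mult_mono) auto
    then show ?thesis by (simp add: mult_ac)
  qed
  ultimately show ?thesis
    using rounded_comparator_regret[OF w N1(1)] unfolding s_def[symmetric] by (simp add: algebra_simps)
qed

section \<open>Comparison of surrogates and losses, and the choice of the width\<close>

lemma f_pred: "f t (x t) = 1 / (2 * \<alpha>)"
  unfolding f_eq q_def using \<alpha> by (simp add: dotp_def power_divide)

text \<open>Surrogates are nonnegative and equal \<open>1 / (2 * \<alpha>)\<close> at the
  prediction. The bound makes the supremum finite and settles paths of length at least
  \<open>n\<close>.\<close>

lemma regret_le_trivial: "(\<Sum>t\<in>{1..n}. f t (x t) - f t (w t)) \<le> real n * (1 / (2 * \<alpha>))"
proof -
  have "(\<Sum>t\<in>{1..n}. f t (x t) - f t (w t)) \<le> (\<Sum>t\<in>{1..n}. 1 / (2 * \<alpha>))"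
    by (intro sum_mono) (simp only: f_pred, simp add: f_eq)
  then show ?thesis by simp
qed

text \<open>The right-hand side is the negative of the quadratic lower model in Assumption B1, so
  under that assumption the surrogate gap dominates the loss gap.\<close>

lemma surr_gap:
  "f t (x t) - f t y = - dotp d (g t) (\<lambda>i. y i - x t i) - \<alpha> / 2 * (dotp d (g t) (\<lambda>i. y i - x t i))\<^sup>2"
proof -
  have "sqrt (\<alpha> / 2) * (1 / sqrt (2 * \<alpha>)) = 1 / 2"
  proof -
    have "sqrt (\<alpha> / 2) * (1 / sqrt (2 * \<alpha>)) = sqrt ((1 / 2)\<^sup>2)"
      unfolding real_sqrt_divide[symmetric] using \<alpha>
      by (simp add: real_sqrt_mult real_sqrt_divide power2_eq_square)
    then show ?thesis by (simp only: real_sqrt_abs)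
  qed
  moreover have "(sqrt (\<alpha> / 2))\<^sup>2 = \<alpha> / 2" "(1 / sqrt (2 * \<alpha>))\<^sup>2 = 1 / (2 * \<alpha>)"
    using \<alpha> by (simp_all add: power_divide)
  moreover have "(u * D + k)\<^sup>2 = u\<^sup>2 * D\<^sup>2 + 2 * (u * k) * D + k\<^sup>2" for u D k :: real
    by (simp add: power2_eq_square algebra_simps)
  ultimately have "f t y = \<alpha> / 2 * (dotp d (g t) (\<lambda>i. y i - x t i))\<^sup>2 + dotp d (g t) (\<lambda>i. y i - x t i) + 1 / (2 * \<alpha>)"
    unfolding f_eq q_def by simp
  then show ?thesis by (simp add: f_pred)
qed

lemma comparators_nonempty: "C \<ge> 0 \<Longrightarrow> comparators d B n C \<noteq> {}"
  using z1 by (auto simp: comparators_def norm1_def intro!: exI[of _ "\<lambda>_. z1"])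

text \<open>With \<open>\<sigma> = 1 / sqrt (real n)\<close> the rounding error is just \<Lambda>
  and \<open>C / \<sigma> \<le> 1\<close>, so the total is \<open>3 * R + \<Lambda>\<close>; hence
  67 = 3 * 22 + 1.\<close>

lemma regret_small_path:
  assumes w: "w \<in> comparators d B n C" and C: "0 \<le> C" "C \<le> 1 / real n"
  shows "(\<Sum>t\<in>{1..n}. f t (x t) - f t (w t)) \<le> 67 * (1 + ln (real n)) * (real d * \<Lambda>)"
proof -
  define \<sigma> where "\<sigma> = 1 / sqrt (real n)"
  have n: "real n \<ge> 1" using n1 by simp
  have sn: "sqrt (real n) \<ge> 1" using n by simp
  have \<sigma>: "0 < \<sigma>" "\<sigma> \<le> 1" using sn by (auto simp: \<sigma>_def)
  have "C / \<sigma> \<le> 1 / real n / \<sigma>" using C \<sigma> by (intro divide_right_mono) auto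
  also have "\<dots> = 1 / sqrt (real n)"
    using n by (simp add: \<sigma>_def real_div_sqrt field_simps)
  also have "\<dots> \<le> 1" using sn by simp
  finally have "R * (1 + 2 * (C / \<sigma>)) \<le> R * 3" using R_nonneg by (intro mult_left_mono) auto
  moreover have "\<Lambda> * (real n * \<sigma>\<^sup>2) = \<Lambda>" using n by (simp add: \<sigma>_def power_divide)
  moreover have "1 * 1 * \<Lambda> \<le> (1 + ln (real n)) * real d * \<Lambda>"
    using n GB_pos \<Lambda>_pos by (intro mult_right_mono mult_mono) auto
  moreover have "R * 3 = 66 * ((1 + ln (real n)) * real d * \<Lambda>)" by (simp add: R_def)
  moreover have "67 * (1 + ln (real n)) * (real d * \<Lambda>) = 67 * ((1 + ln (real n)) * real d * \<Lambda>)"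
    by simp
  ultimately show ?thesis using tracking_regret[OF w \<sigma> C(1)] by linarith
qed

text \<open>The width \<open>(C / real n) powr (1/3)\<close> makes \<open>C / \<sigma>\<close> and
  \<open>real n * \<sigma>\<^sup>2\<close> both equal to \<open>X\<close>. It is at most 1 only for
  \<open>C \<le> real n\<close>; for longer paths \<open>X \<ge> real n\<close> and the trivial
  bound suffices.\<close>

lemma regret_large_path:
  assumes w: "w \<in> comparators d B n C" and C: "C > 1 / real n"
  shows "(\<Sum>t\<in>{1..n}. f t (x t) - f t (w t))
    \<le> 67 * (1 + ln (real n)) * (real d * \<Lambda>) * max (real n powr (1/3) * C powr (2/3)) 1"
proof -
  define X where "X = real n powr (1/3) * C powr (2/3)"
  have n: "real n \<ge> 1" using n1 by simp
  have Cp: "C > 0" using C n by (smt (verit) divide_pos_pos)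
  have X: "X \<ge> 0" by (simp add: X_def)
  have l1: "1 * 1 * \<Lambda> \<le> (1 + ln (real n)) * real d * \<Lambda>"
    using n GB_pos \<Lambda>_pos by (intro mult_right_mono mult_mono) auto
  have "(\<Sum>t\<in>{1..n}. f t (x t) - f t (w t)) \<le> 67 * (1 + ln (real n)) * (real d * \<Lambda>) * max X 1"
  proof (cases "C \<ge> real n")
    case True
    have "real n = real n powr (1/3) * real n powr (2/3)" using n by (simp flip: powr_add)
    also have "\<dots> \<le> X" unfolding X_def using True n by (intro mult_left_mono powr_mono2) auto
    finally have nX: "real n \<le> max X 1" by simp
    have "1 / (2 * \<alpha>) \<le> 1 / \<alpha>" using \<alpha> by (simp add: field_simps)
    also have "\<dots> \<le> \<Lambda>" unfolding \<Lambda>_def using \<alpha> by simp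
    also have "\<dots> \<le> 67 * (1 + ln (real n)) * (real d * \<Lambda>)"
      using l1 \<Lambda>_pos unfolding mult.assoc by linarith
    finally have "real n * (1 / (2 * \<alpha>)) \<le> max X 1 * (67 * (1 + ln (real n)) * (real d * \<Lambda>))"
      using nX \<alpha> by (intro mult_mono) auto
    then show ?thesis using regret_le_trivial[of w] by (simp add: mult_ac)
  next
    case False
    define \<sigma> where "\<sigma> = (C / real n) powr (1/3)"
    have \<sigma>: "0 < \<sigma>" "\<sigma> \<le> 1"
      unfolding \<sigma>_def using False n Cp powr_le1[of "1/3" "C / real n"] by auto
    have \<sigma>': "\<sigma> = C powr (1/3) / real n powr (1/3)"
      unfolding \<sigma>_def using Cp n by (simp add: powr_divide)
    have "C / \<sigma> = C powr 1 * real n powr (1/3) / C powr (1/3)" using Cp by (simp add: \<sigma>')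
    also have "\<dots> = real n powr (1/3) * (C powr 1 / C powr (1/3))" by simp
    also have "C powr 1 / C powr (1/3) = C powr (2/3)" by (subst powr_diff[symmetric]) simp
    finally have CX: "C / \<sigma> = X" by (simp add: X_def)
    have "real n * \<sigma>\<^sup>2 = real n powr 1 * (C powr (2/3) / real n powr (2/3))"
      using n Cp unfolding \<sigma>' by (simp add: power_divide power2_eq_square flip: powr_add)
    also have "\<dots> = (real n powr 1 / real n powr (2/3)) * C powr (2/3)" by simp
    also have "real n powr 1 / real n powr (2/3) = real n powr (1/3)" by (subst powr_diff[symmetric]) simp
    finally have nX: "real n * \<sigma>\<^sup>2 = X" by (simp add: X_def)
    have "(\<Sum>t\<in>{1..n}. f t (x t) - f t (w t)) \<le> R * (1 + 2 * X) + \<Lambda> * X"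
      using tracking_regret[OF w \<sigma>] Cp CX nX by simp
    also have "\<dots> \<le> R * (3 * max X 1) + \<Lambda> * max X 1"
      using R_nonneg \<Lambda>_pos by (intro add_mono mult_left_mono) auto
    also have "\<dots> = (3 * R + \<Lambda>) * max X 1" by (simp add: algebra_simps)
    also have "\<dots> \<le> 67 * (1 + ln (real n)) * (real d * \<Lambda>) * max X 1"
    proof (rule mult_right_mono)
      show "3 * R + \<Lambda> \<le> 67 * (1 + ln (real n)) * (real d * \<Lambda>)"
        using l1 by (simp add: R_def algebra_simps)
    qed (use X in simp)
    finally show ?thesis .
  qed
  then show ?thesis by (simp add: X_def)
qed

end

text \<open>The witnesses are 67 and exponent 1, the same for all parameters. The quantifier order
  expresses that the hidden constants depend neither on the dimension nor on the losses.\<close>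

theorem theorem3:
  "\<exists>K>0. \<exists>p::nat. \<forall>(d::nat) (B::real) (G::real) (Ginf::real) (\<alpha>::real) (z1::rvec)
       (loss::nat \<Rightarrow> rvec \<Rightarrow> real) (gr::nat \<Rightarrow> rvec \<Rightarrow> rvec) (n::nat) (C::real).
     d \<ge> 1 \<and> n \<ge> 1 \<and> C \<ge> 0 \<and> \<alpha> > 0 \<and> G \<ge> 1 \<and> Ginf \<ge> 1 \<and> B \<ge> 1 \<and> z1 \<in> domD d B \<and>
     (\<forall>t\<in>{1..n}. convex_Rd d (loss t)
        \<and> (\<forall>x. vsupp d x \<longrightarrow> has_grad d (loss t) x (gr t x))
        \<and> (\<forall>x\<in>domD d B. \<forall>y\<in>domD d B.
             loss t y \<ge> loss t x + dotp d (gr t x) (\<lambda>i. y i - x i)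
                      + \<alpha> / 2 * (dotp d (gr t x) (\<lambda>i. y i - x i))\<^sup>2)
        \<and> (\<forall>x\<in>domD d B. norm2 d (gr t x) \<le> G \<and> norminf d (gr t x) \<le> Ginf))
     \<longrightarrow>
     (let x = flh_pred d B G \<alpha> z1 gr;
          f = (\<lambda>t. surr d \<alpha> (gr t (x t)) (x t));
          S = Sup ((\<lambda>w. \<Sum>t\<in>{1..n}. f t (x t) - f t (w t)) ` comparators d B n C);
          L = K * (1 + ln (real n)) ^ p
      in dyn_regret d B n C loss x \<le> S \<and>
         S \<le> L * (140 * (real d)\<^sup>2 * (8 * G\<^sup>2 * B\<^sup>2 * \<alpha> * real d + G\<^sup>2 * B\<^sup>2 + 1 / \<alpha>)
                    * max (real n powr (1/3) * C powr (2/3)) 1) * (if C > 1 / real n then 1 else 0)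
            + L * (real d * (8 * G\<^sup>2 * B\<^sup>2 * \<alpha> * real d + 1 / \<alpha>)) * (if C \<le> 1 / real n then 1 else 0))"
proof (rule exI[of _ 67], rule conjI, simp, rule exI[of _ 1], intro allI impI)
  fix d :: nat and B G Ginf \<alpha> :: real and z1 :: rvec and loss :: "nat \<Rightarrow> rvec \<Rightarrow> real"
    and gr :: "nat \<Rightarrow> rvec \<Rightarrow> rvec" and n :: nat and C :: real
  assume asm: "d \<ge> 1 \<and> n \<ge> 1 \<and> C \<ge> 0 \<and> \<alpha> > 0 \<and> G \<ge> 1 \<and> Ginf \<ge> 1 \<and> B \<ge> 1 \<and> z1 \<in> domD d B \<and>
     (\<forall>t\<in>{1..n}. convex_Rd d (loss t)
        \<and> (\<forall>x. vsupp d x \<longrightarrow> has_grad d (loss t) x (gr t x))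
        \<and> (\<forall>x\<in>domD d B. \<forall>y\<in>domD d B.
             loss t y \<ge> loss t x + dotp d (gr t x) (\<lambda>i. y i - x i)
                      + \<alpha> / 2 * (dotp d (gr t x) (\<lambda>i. y i - x i))\<^sup>2)
        \<and> (\<forall>x\<in>domD d B. norm2 d (gr t x) \<le> G \<and> norminf d (gr t x) \<le> Ginf))"
  interpret run: flh_run d B G \<alpha> z1 gr n
    by unfold_locales (use asm in \<open>auto simp: has_grad_def domD_def\<close>)
  have C: "C \<ge> 0" using asm by simp
  have curv: "loss t y \<ge> loss t x + dotp d (gr t x) (\<lambda>i. y i - x i) + \<alpha> / 2 * (dotp d (gr t x) (\<lambda>i. y i - x i))\<^sup>2"
    if "t \<in> {1..n}" "x \<in> domD d B" "y \<in> domD d B" for t x y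
    using asm that by blast
  define reg where "reg = (\<lambda>w. \<Sum>t\<in>{1..n}. run.f t (run.x t) - run.f t (w t))"
  define S where "S = Sup (reg ` comparators d B n C)"
  \<comment> \<open>A real \<open>Sup\<close> is meaningful only for a nonempty set bounded above:
    constant sequences give the first, and the trivial regret bound the second.\<close>
  have ne: "comparators d B n C \<noteq> {}" by (rule run.comparators_nonempty[OF C])
  have bdd: "bdd_above (reg ` comparators d B n C)"
    unfolding reg_def using run.regret_le_trivial by (intro bdd_aboveI) auto
  have "dyn_regret d B n C loss run.x \<le> S"
    unfolding dyn_regret_def
  proof (rule cSup_least)
    fix r assume "r \<in> (\<lambda>w. \<Sum>t\<in>{1..n}. loss t (run.x t) - loss t (w t)) ` comparators d B n C"
    then obtain w where w: "w \<in> comparators d B n C"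
      and r: "r = (\<Sum>t\<in>{1..n}. loss t (run.x t) - loss t (w t))" by auto
    have "r \<le> reg w" unfolding r reg_def
    proof (rule sum_mono)
      fix t assume t: "t \<in> {1..n}"
      then have "w t \<in> domD d B" using w by (simp add: comparators_def)
      from curv[OF t run.x_domD'[OF t] this]
      show "loss t (run.x t) - loss t (w t) \<le> run.f t (run.x t) - run.f t (w t)"
        unfolding run.surr_gap run.g_def by linarith
    qed
    also have "\<dots> \<le> S" unfolding S_def using w bdd by (intro cSup_upper) auto
    finally show "r \<le> S" .
  qed (use ne in simp)
  moreover have "S \<le> 67 * (1 + ln (real n)) * (real d * run.\<Lambda>)" if "C \<le> 1 / real n"
    unfolding S_def
    by (rule cSup_least) (use ne run.regret_small_path[OF _ C that] in \<open>auto simp: reg_def\<close>)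
  moreover have "S \<le> 67 * (1 + ln (real n)) * (140 * (real d)\<^sup>2 *
      (8 * G\<^sup>2 * B\<^sup>2 * \<alpha> * real d + G\<^sup>2 * B\<^sup>2 + 1 / \<alpha>) * max (real n powr (1/3) * C powr (2/3)) 1)"
    if "C > 1 / real n"
  proof -
    have "S \<le> 67 * (1 + ln (real n)) * (real d * run.\<Lambda>) * max (real n powr (1/3) * C powr (2/3)) 1"
      unfolding S_def
      by (rule cSup_least) (use ne run.regret_large_path[OF _ that] in \<open>auto simp: reg_def\<close>)
    also have "\<dots> = 67 * (1 + ln (real n)) * (real d * run.\<Lambda> * max (real n powr (1/3) * C powr (2/3)) 1)"
      by (simp only: mult.assoc)
    also have "\<dots> \<le> 67 * (1 + ln (real n)) * (140 * (real d)\<^sup>2 *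
      (8 * G\<^sup>2 * B\<^sup>2 * \<alpha> * real d + G\<^sup>2 * B\<^sup>2 + 1 / \<alpha>) * max (real n powr (1/3) * C powr (2/3)) 1)"
    \<comment> \<open>The proven factor is \<open>real d * \<Lambda>\<close>; it is enlarged to the
      stated one by \<open>real d \<le> 140 * (real d)\<^sup>2\<close> and the extra summand
      \<open>G\<^sup>2 * B\<^sup>2\<close>.\<close>
    proof (intro mult_left_mono mult_right_mono mult_mono)
      have "1 * real d \<le> real d * real d" using run.GB_pos by (intro mult_right_mono) auto
      then show "real d \<le> 140 * (real d)\<^sup>2" by (simp add: power2_eq_square)
      show "run.\<Lambda> \<le> 8 * G\<^sup>2 * B\<^sup>2 * \<alpha> * real d + G\<^sup>2 * B\<^sup>2 + 1 / \<alpha>"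
        by (simp add: run.\<Lambda>_def)
    qed (use run.\<Lambda>_pos run.n1 in auto)
    finally show ?thesis .
  qed
  ultimately show "let x = flh_pred d B G \<alpha> z1 gr;
          f = (\<lambda>t. surr d \<alpha> (gr t (x t)) (x t));
          S = Sup ((\<lambda>w. \<Sum>t\<in>{1..n}. f t (x t) - f t (w t)) ` comparators d B n C);
          L = 67 * (1 + ln (real n)) ^ 1
      in dyn_regret d B n C loss x \<le> S \<and>
         S \<le> L * (140 * (real d)\<^sup>2 * (8 * G\<^sup>2 * B\<^sup>2 * \<alpha> * real d + G\<^sup>2 * B\<^sup>2 + 1 / \<alpha>)
                    * max (real n powr (1/3) * C powr (2/3)) 1) * (if C > 1 / real n then 1 else 0)
            + L * (real d * (8 * G\<^sup>2 * B\<^sup>2 * \<alpha> * real d + 1 / \<alpha>)) * (if C \<le> 1 / real n then 1 else 0)"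
    unfolding Let_def run.x_def[symmetric] run.g_def[symmetric] run.f_def[symmetric]
      reg_def[symmetric] S_def[symmetric] run.\<Lambda>_def[symmetric]
    by auto
qed

end
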